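(* Let $X$ be a uniformly convex and uniformly smooth real Banach space whose modulus of smoothness is of power type $s$, $s\in(1,2]$. Then there are positive constants $\beta_I$ and $L_I$ (not depending on $A$, $R$, $x_0$, $x_1$ below) with the following property. Let $R>0$, let $A\subset X$ be a proximally smooth set with constant $R$, and let $x_0,x_1\in A$ be distinct points with $\frac{\|x_0-x_1\|}{R}<\beta_I$. Then the curve-construction algorithm (described in the context) applied to $A,x_0,x_1$ returns a curve $\gamma$ in $A$ with endpoints $x_0$ and $x_1$ (that is, at every step the required slice-projections exist, and, for whatever choice of them, the resulting function $f$ on the dyadic rationals of $[0,1]$ extends to a continuous map $f:[0,1]\to A$ with $f(0)=x_0$, $f(1)=x_1$; $\gamma=f([0,1])$), such that $$\gamma\subset\mathrm{conv}\left(\{x_0\}\cup B_r\!\left(\tfrac{x_0+x_1}{2}\right)\cup\{x_1\}\right),$$ where $B_r\left(\frac{x_0+x_1}{2}\right)$ is the closed ball centered at $\frac{x_0+x_1}{2}$ of radius $$r=L_I\|x_0-x_1\|\left(\frac{\|x_0-x_1\|}{R}\right)^{s-1}.$$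
   Context: Modulus of smoothness: $\varrho_X(\tau)=\sup\left\{\frac{\|x+y\|+\|x-y\|}{2}-1:\ \|x\|=1,\ \|y\|=\tau\right\}$, $\tau\ge 0$. It is of power type $s$ if there is a constant $C_{sm}$ with $\varrho_X(\tau)\le C_{sm}\tau^s$ for all $\tau\ge0$; here $s\in(1,2]$. $X$ is uniformly smooth if $\varrho_X(\tau)/\tau\to0$ as $\tau\to0$. Uniform convexity is the usual notion. Distance and metric projection: $\mathrm{dist}(x,A)=\inf_{a\in A}\|x-a\|$, $P_A(x)=\{a\in A:\|a-x\|=\mathrm{dist}(x,A)\}$, and $P_A([x_0,x_1])=\bigcup_{x\in[x_0,x_1]}P_A(x)$. A set $A\subset X$ is proximally smooth with constant $R>0$ if it is closed and the function $x\mapsto \mathrm{dist}(x,A)$ is continuously differentiable on the open set $\{x\in X:0<\mathrm{dist}(x,A)<R\}$. For a non-zero $x\in X$ let $p\in X^*$ be the unique unit functional with $\langle p,x\rangle=\|x\|$, and let $H_x=\{y\in X:\langle p,y\rangle=0\}$. Slice-projection: for distinct points $u,v\in A$ with $\|u-v\|<2R$, a slice-projection of the midpoint $\frac{u+v}{2}$ of the segment $[u,v]$ onto $A$ is any point of the set $P_A([u,v])\cap\left(H_{u-v}+\frac{u+v}{2}\right)$. Curve-construction algorithm. Input: a proximally smooth set $A$ with constant $R$ and distinct $x_0,x_1\in A$. Let $S_i=\{j/2^i: j=0,1,\dots,2^i\}$ for $i\ge0$. (1) Put $f(0)=x_0$, $f(1)=x_1$. (2) For $i=1,2,\dots$, extend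 $f$ from $S_{i-1}$ to $S_i$ by letting $f\left(\frac{2j-1}{2^i}\right)$ be a slice-projection onto $A$ of the midpoint of the segment $\left[f\left(\frac{j-1}{2^{i-1}}\right),f\left(\frac{j}{2^{i-1}}\right)\right]$, for each $j\in\{1,\dots,2^{i-1}\}$. (3) Extend $f$ continuously to $[0,1]$. Output: the curve $\gamma=f([0,1])$, parametrized by $f$. *)

theory Defs
  imports "HOL-Analysis.Analysis"
begin

definition uniformly_convex_space :: "'a::real_normed_vector itself \<Rightarrow> bool" where
  "uniformly_convex_space _ \<longleftrightarrow>
     (\<forall>\<epsilon>>0. \<exists>\<delta>>0. \<forall>x y :: 'a.
        norm x = 1 \<longrightarrow> norm y = 1 \<longrightarrow> norm (x - y) \<ge> \<epsilon> \<longrightarrow> norm ((1/2) *\<^sub>R (x + y)) \<le> 1 - \<delta>)"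

text \<open>For \<open>\<tau> \<ge> 0\<close> the set below is bounded above by \<open>\<tau>\<close> and empty only in the zero space.\<close>
definition modulus_of_smoothness :: "'a::real_normed_vector itself \<Rightarrow> real \<Rightarrow> real" where
  "modulus_of_smoothness _ \<tau> =
     Sup {(norm (x + y) + norm (x - y)) / 2 - 1 | x y :: 'a. norm x = 1 \<and> norm y = \<tau>}"

definition uniformly_smooth_space :: "'a::real_normed_vector itself \<Rightarrow> bool" where
  "uniformly_smooth_space X \<longleftrightarrow>
     ((\<lambda>\<tau>. modulus_of_smoothness X \<tau> / \<tau>) \<longlongrightarrow> 0) (at_right 0)"

definition smoothness_of_power_type :: "'a::real_normed_vector itself \<Rightarrow> real \<Rightarrow> bool" where
  "smoothness_of_power_type X s \<longleftrightarrow>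
     (\<exists>C. \<forall>\<tau>\<ge>0. modulus_of_smoothness X \<tau> \<le> C * \<tau> powr s)"

definition metric_projection :: "'a::real_normed_vector set \<Rightarrow> 'a \<Rightarrow> 'a set" where
  "metric_projection A x = {a \<in> A. norm (a - x) = infdist x A}"

text \<open>Differentiability is in the sense of Frechet, and the derivative is continuous in the
  operator norm.\<close>
definition proximally_smooth :: "real \<Rightarrow> 'a::real_normed_vector set \<Rightarrow> bool" where
  "proximally_smooth R A \<longleftrightarrow>
     R > 0 \<and> closed A \<and>
     (\<exists>D :: 'a \<Rightarrow> 'a \<Rightarrow>\<^sub>L real.
        (\<forall>x\<in>{x. 0 < infdist x A \<and> infdist x A < R}.
           ((\<lambda>z. infdist z A) has_derivative blinfun_apply (D x)) (at x)) \<and>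
        continuous_on {x. 0 < infdist x A \<and> infdist x A < R} D)"

text \<open>For \<open>x \<noteq> 0\<close> such a functional exists by Hahn-Banach; it is unique when the space is smooth.\<close>
definition supporting_functional :: "'a::real_normed_vector \<Rightarrow> 'a \<Rightarrow>\<^sub>L real" where
  "supporting_functional x = (THE p. norm p = 1 \<and> blinfun_apply p x = norm x)"

definition supporting_hyperplane :: "'a::real_normed_vector \<Rightarrow> 'a set" where
  "supporting_hyperplane x = {y. blinfun_apply (supporting_functional x) y = 0}"

text \<open>The conditions on \<open>u\<close> and \<open>v\<close> under which slice-projections are defined are part of the
  predicate, so the existence of a slice-projection includes their validity.\<close>
definition slice_projection ::
  "'a::real_normed_vector set \<Rightarrow> real \<Rightarrow> 'a \<Rightarrow> 'a \<Rightarrow> 'a \<Rightarrow> bool" where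
  "slice_projection A R u v q \<longleftrightarrow>
     u \<in> A \<and> v \<in> A \<and> u \<noteq> v \<and> norm (u - v) < 2 * R \<and>
     q \<in> (\<Union>x\<in>closed_segment u v. metric_projection A x) \<inter>
         ((\<lambda>h. h + midpoint u v) ` supporting_hyperplane (u - v))"

definition dyadic_level :: "nat \<Rightarrow> real set" where
  "dyadic_level i = {real j / 2 ^ i | j. j \<le> 2 ^ i}"

text \<open>The values of \<open>f\<close> on \<open>dyadic_level n\<close> are a possible result of the first \<open>n\<close> refinement
  steps of the curve construction; the values of \<open>f\<close> elsewhere are irrelevant. Refinement step
  \<open>i + 1\<close> defines \<open>f\<close> at the midpoint of \<open>[(j - 1) / 2 ^ i, j / 2 ^ i]\<close>.\<close>
definition curve_construction_upto ::
  "'a::real_normed_vector set \<Rightarrow> real \<Rightarrow> 'a \<Rightarrow> 'a \<Rightarrow> nat \<Rightarrow> (real \<Rightarrow> 'a) \<Rightarrow> bool" where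
  "curve_construction_upto A R x0 x1 n f \<longleftrightarrow>
     f 0 = x0 \<and> f 1 = x1 \<and>
     (\<forall>i<n. \<forall>j\<in>{1..2 ^ i :: nat}.
        slice_projection A R (f ((real j - 1) / 2 ^ i)) (f (real j / 2 ^ i))
          (f ((2 * real j - 1) / 2 ^ (i + 1))))"

end

theory Submission
  imports Defs
begin

text \<open>
  A Frechet differentiable distance function has unit slope off \<open>A\<close>, which by uniform convexity makes
  the metric projection single-valued and continuous on the tube of radius \<open>R\<close>. By Ekeland's
  principle one can climb away from \<open>A\<close> at almost unit rate, and uniform convexity forces this climb
  to follow the normal ray; so the open balls of radius less than \<open>R\<close> touching \<open>A\<close> at a projection
  miss \<open>A\<close>. Since \<open>u, v\<close> lie outside such a ball, smoothness of power type \<open>s\<close> shows that the segment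
  \<open>[u, v]\<close> enters it to depth at most \<open>K l (l / R)^(s - 1)\<close> with \<open>l = \<parallel>u - v\<parallel>\<close>, and a slice-projection
  is that close to the midpoint. Slice-projections exist by the intermediate value theorem.

  Chord lengths at level \<open>i\<close> therefore decay geometrically, hence are \<open>O(2^-i)\<close>, so that the
  construction is Lipschitz on the dyadic rationals; and its deviation from the affine parametrization
  of \<open>[x0, x1]\<close> at time \<open>t\<close> is at most \<open>2 r min t (1 - t)\<close>, which places it in the convex hull.
\<close>

section \<open>Ekeland's principle and the slope of the distance function\<close>

text \<open>Read \<open>z \<in> G y\<close> as an order: the gain in \<open>f\<close> pays for the
  distance at price \<open>c\<close>. A chain realizing at each step at least half of the attainable
  gain is Cauchy because \<open>f\<close> is bounded along it, and nothing is left to gain at its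
  limit.\<close>

lemma ekeland_maximum:
  fixes f :: "'a::complete_space \<Rightarrow> real"
  assumes cont: "continuous_on UNIV f" and bdd: "\<And>y. f y \<le> T" and c: "c > 0"
  obtains y where "f x + c * dist y x \<le> f y" "\<And>z. f y + c * dist z y \<le> f z \<Longrightarrow> z = y"
proof -
  define G where "G y = {z. f y + c * dist z y \<le> f z}" for y
  have self: "y \<in> G y" for y by (simp add: G_def)
  have trans: "w \<in> G y" if "z \<in> G y" "w \<in> G z" for y z w
  proof -
    have "c * dist w y \<le> c * (dist w z + dist z y)"
      using c by (intro mult_left_mono dist_triangle) auto
    then show ?thesis using that by (simp add: G_def algebra_simps)
  qed
  have bddG: "bdd_above (f ` G y)" for y
    by (rule bdd_aboveI[of _ T]) (use bdd in auto)
  have "\<exists>z. z \<in> G y \<and> (f y + Sup (f ` G y)) / 2 \<le> f z" for y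
  proof (cases "Sup (f ` G y) \<le> f y")
    case True
    then show ?thesis using self by (intro exI[of _ y]) auto
  next
    case False
    then have "(f y + Sup (f ` G y)) / 2 < Sup (f ` G y)" by simp
    then obtain z where "z \<in> G y" "(f y + Sup (f ` G y)) / 2 < f z"
      using less_cSup_iff[OF _ bddG, of y] self by blast
    then show ?thesis by (intro exI[of _ z]) auto
  qed
  then obtain nxt where nxt: "nxt y \<in> G y" "(f y + Sup (f ` G y)) / 2 \<le> f (nxt y)" for y
    by metis
  define Y where "Y n = (nxt ^^ n) x" for n
  have Y_Suc: "Y (Suc n) = nxt (Y n)" for n by (simp add: Y_def)
  have YG: "Y n \<in> G (Y m)" if "m \<le> n" for m n
    using that
  proof (induction rule: dec_induct)
    case base show ?case by (rule self)
  next
    case (step k)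
    show ?case unfolding Y_Suc by (rule trans[OF step.IH nxt(1)])
  qed
  have Ydist: "f (Y m) + c * dist (Y n) (Y m) \<le> f (Y n)" if "m \<le> n" for m n
    using YG[OF that] by (simp add: G_def)
  have "incseq (\<lambda>n. f (Y n))"
  proof (rule incseq_SucI)
    fix n
    have "0 \<le> c * dist (Y (Suc n)) (Y n)" using c by simp
    then show "f (Y n) \<le> f (Y (Suc n))" using Ydist[of n "Suc n"] by linarith
  qed
  then have "convergent (\<lambda>n. f (Y n))"
    using incseq_convergent[of "\<lambda>n. f (Y n)" T] bdd unfolding convergent_def by blast
  then have CfY: "Cauchy (\<lambda>n. f (Y n))" by (rule convergent_Cauchy)
  have "Cauchy Y"
  proof (rule CauchyI')
    fix e :: real assume "e > 0"
    then have "c * e > 0" using c by simp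
    then obtain M where M: "\<And>m n. m \<ge> M \<Longrightarrow> n \<ge> M \<Longrightarrow> dist (f (Y m)) (f (Y n)) < c * e"
      using CfY unfolding Cauchy_def by blast
    show "\<exists>M. \<forall>m\<ge>M. \<forall>n>m. dist (Y m) (Y n) < e"
    proof (intro exI[of _ M] allI impI)
      fix m n assume "M \<le> m" "m < n"
      then have "dist (f (Y m)) (f (Y n)) < c * e" using M by simp
      moreover have "c * dist (Y n) (Y m) \<le> f (Y n) - f (Y m)"
        using Ydist[of m n] \<open>m < n\<close> by simp
      ultimately have "c * dist (Y n) (Y m) < c * e" by (simp add: dist_real_def)
      then show "dist (Y m) (Y n) < e" using c by (simp add: dist_commute)
    qed
  qed
  then obtain y where y: "Y \<longlonglongrightarrow> y"
    using Cauchy_convergent convergent_def by blast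
  have fy: "(\<lambda>n. f (Y n)) \<longlonglongrightarrow> f y"
    by (rule continuous_on_tendsto_compose[OF cont y]) auto
  have yG: "y \<in> G (Y m)" for m
  proof -
    have "f (Y m) + c * dist y (Y m) \<le> f y"
    proof (rule LIMSEQ_le)
      show "(\<lambda>n. f (Y m) + c * dist (Y n) (Y m)) \<longlonglongrightarrow> f (Y m) + c * dist y (Y m)"
        by (intro tendsto_intros y)
      show "\<exists>N. \<forall>n\<ge>N. f (Y m) + c * dist (Y n) (Y m) \<le> f (Y n)" using Ydist by blast
    qed (rule fy)
    then show ?thesis by (simp add: G_def)
  qed
  show thesis
  proof
    show "f x + c * dist y x \<le> f y" using yG[of 0] by (simp add: G_def Y_def)
    fix z assume z: "f y + c * dist z y \<le> f z"
    \<comment> \<open>A point above \<open>y\<close> is above every \<open>Y n\<close>, so the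
      half-gain rule bounds \<open>f z\<close> by \<open>f (Y (Suc n))\<close> plus the last gain,
      which tends to zero.\<close>
    have "f z \<le> f y + (f y - f y)"
    proof (rule LIMSEQ_le[OF tendsto_const])
      show "(\<lambda>n. f (Y (Suc n)) + (f (Y (Suc n)) - f (Y n))) \<longlonglongrightarrow> f y + (f y - f y)"
        by (intro tendsto_intros fy LIMSEQ_Suc[OF fy])
      have "f z \<le> f (Y (Suc n)) + (f (Y (Suc n)) - f (Y n))" for n
      proof -
        have "z \<in> G (Y n)" by (rule trans[OF yG]) (use z in \<open>simp add: G_def\<close>)
        then have "f z \<le> Sup (f ` G (Y n))" by (intro cSup_upper bddG) auto
        moreover have "(f (Y n) + Sup (f ` G (Y n))) / 2 \<le> f (Y (Suc n))"
          unfolding Y_Suc by (rule nxt)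
        ultimately show ?thesis by simp
      qed
      then show "\<exists>N. \<forall>n\<ge>N. f z \<le> f (Y (Suc n)) + (f (Y (Suc n)) - f (Y n))" by blast
    qed
    with z have "c * dist z y \<le> 0" by simp
    then show "z = y" using c by (simp add: mult_le_0_iff)
  qed
qed

section \<open>Uniform convexity and the derivative of the distance\<close>

lemma uniformly_convexD:
  assumes "uniformly_convex_space TYPE('a::real_normed_vector)" "\<epsilon> > 0"
  obtains \<delta> where "\<delta> > 0"
    "\<And>x y :: 'a. norm x = 1 \<Longrightarrow> norm y = 1 \<Longrightarrow> norm (x + y) > 2 - \<delta> \<Longrightarrow> norm (x - y) < \<epsilon>"
proof -
  obtain \<delta> where \<delta>: "\<delta> > 0" "\<And>x y :: 'a. norm x = 1 \<Longrightarrow> norm y = 1 \<Longrightarrow> norm (x - y) \<ge> \<epsilon> \<Longrightarrow>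
      norm ((1/2) *\<^sub>R (x + y)) \<le> 1 - \<delta>"
    using assms unfolding uniformly_convex_space_def by blast
  show thesis
  proof (rule that[of \<delta>])
    fix x y :: 'a assume *: "norm x = 1" "norm y = 1" "norm (x + y) > 2 - \<delta>"
    have "norm ((1/2) *\<^sub>R (x + y)) = norm (x + y) / 2" by simp
    then show "norm (x - y) < \<epsilon>" using \<delta>(2)[OF *(1,2)] *(3) \<delta>(1) by force
  qed (rule \<delta>)
qed

lemma infdist_near:
  assumes "A \<noteq> {}" "\<eta> > 0"
  obtains a where "a \<in> A" "dist x a < infdist x A + \<eta>"
proof -
  have "\<not> (\<forall>a\<in>A. infdist x A + \<eta> \<le> dist x a)"
  proof
    assume "\<forall>a\<in>A. infdist x A + \<eta> \<le> dist x a"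
    then have "infdist x A + \<eta> \<le> infdist x A"
      using assms(1) by (subst (2) infdist_notempty) (auto intro: cINF_greatest)
    then show False using assms(2) by simp
  qed
  then show thesis using that by force
qed

lemma infdist_Lipschitz: "\<bar>infdist x A - infdist y A\<bar> \<le> norm (x - y)"
  for x y :: "'a::real_normed_vector"
  using infdist_triangle[of x A y] infdist_triangle[of y A x] by (simp add: dist_norm norm_minus_commute)

text \<open>Moving from \<open>x\<close> a fraction \<open>t\<close> of the way towards a
  near-minimizer \<open>a\<close> lowers the distance by almost \<open>t * norm (x - a)\<close>; the
  first-order expansion turns this into a bound on the derivative.\<close>

lemma infdist_derivative_near:
  fixes x :: "'a::real_normed_vector"
  assumes D: "((\<lambda>z. infdist z A) has_derivative D) (at x)" and pos: "infdist x A > 0" and "\<epsilon> > 0"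
  obtains \<eta> where "\<eta> > 0"
    "\<And>a. a \<in> A \<Longrightarrow> norm (x - a) < infdist x A + \<eta> \<Longrightarrow> (1 - \<epsilon>) * norm (x - a) \<le> D (x - a)"
proof -
  interpret D: bounded_linear D using D by (rule has_derivative_bounded_linear)
  obtain \<delta> where \<delta>: "\<delta> > 0" "\<And>y. norm (y - x) < \<delta> \<Longrightarrow>
      norm (infdist y A - infdist x A - D (y - x)) \<le> (\<epsilon> / 2) * norm (y - x)"
    using D \<open>\<epsilon> > 0\<close> unfolding has_derivative_at_alt by (metis half_gt_zero)
  define d where "d = infdist x A"
  \<comment> \<open>Near-minimizers lie within \<open>d + 1\<close> of \<open>x\<close>, so this
    \<open>t\<close> keeps the displacement in the range of the expansion.\<close>
  define t where "t = min 1 (\<delta> / (2 * (d + 1)))"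
  have d: "d > 0" using pos by (simp add: d_def)
  have t: "t > 0" "t \<le> 1" "t * (d + 1) < \<delta>"
  proof -
    show "t > 0" "t \<le> 1" using \<delta> d by (auto simp: t_def)
    have "t * (d + 1) \<le> \<delta> / (2 * (d + 1)) * (d + 1)"
      using d by (intro mult_right_mono) (auto simp: t_def)
    also have "\<dots> = \<delta> / 2" using d by (simp add: field_simps)
    also have "\<dots> < \<delta>" using \<delta> by simp
    finally show "t * (d + 1) < \<delta>" .
  qed
  \<comment> \<open>The slack of a near-minimizer may cost half of \<epsilon>; the other half is the
    expansion error.\<close>
  define \<eta> where "\<eta> = min 1 ((\<epsilon> / 2) * t * d)"
  show thesis
  proof (rule that[of \<eta>])
    show "\<eta> > 0" using t d \<open>\<epsilon> > 0\<close> by (simp add: \<eta>_def)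
    fix a assume a: "a \<in> A" "norm (x - a) < infdist x A + \<eta>"
    define w where "w = norm (x - a)"
    have w: "d \<le> w" "w < d + 1" "w < d + (\<epsilon> / 2) * t * d"
      using a infdist_le[OF a(1), of x] by (auto simp: w_def d_def \<eta>_def dist_norm)
    define y where "y = x - t *\<^sub>R (x - a)"
    have nyx: "norm (y - x) = t * w" using t by (simp add: y_def w_def)
    have "t * w \<le> t * (d + 1)" using w t by (intro mult_left_mono) auto
    then have "norm (infdist y A - infdist x A - D (y - x)) \<le> (\<epsilon> / 2) * (t * w)"
      using \<delta>(2)[of y] t unfolding nyx by linarith
    moreover have "D (y - x) = - t * D (x - a)"
      by (simp add: y_def D.neg D.scaleR)
    moreover have "infdist y A \<le> (1 - t) * w"
    proof -
      have "y - a = (1 - t) *\<^sub>R (x - a)" by (simp add: y_def algebra_simps)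
      then have "dist y a = (1 - t) * w" using t by (simp add: dist_norm w_def)
      then show ?thesis using infdist_le[OF a(1), of y] by simp
    qed
    ultimately have "d - t * D (x - a) - (\<epsilon> / 2) * (t * w) \<le> (1 - t) * w"
      unfolding d_def real_norm_def by linarith
    then have "t * w - (\<epsilon> / 2) * t * d - (\<epsilon> / 2) * (t * w) \<le> t * D (x - a)"
      using w by (simp add: algebra_simps)
    moreover have "(\<epsilon> / 2) * t * d \<le> (\<epsilon> / 2) * t * w"
      using w t \<open>\<epsilon> > 0\<close> by (intro mult_left_mono) auto
    ultimately have "t * ((1 - \<epsilon>) * w) \<le> t * D (x - a)"
      by (simp add: algebra_simps)
    then show "(1 - \<epsilon>) * norm (x - a) \<le> D (x - a)" using t by (simp add: w_def)
  qed
qed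

text \<open>Holds because the distance is 1-Lipschitz. Together with the preceding bound, directions
  to near-minimizers almost norm the derivative.\<close>

lemma infdist_derivative_le:
  fixes x :: "'a::real_normed_vector"
  assumes D: "((\<lambda>z. infdist z A) has_derivative D) (at x)"
  shows "D h \<le> norm h"
proof (cases "h = 0")
  case True
  then show ?thesis using has_derivative_bounded_linear[OF D] by (simp add: linear_simps)
next
  case False
  interpret D: bounded_linear D using D by (rule has_derivative_bounded_linear)
  show ?thesis
  proof (rule field_le_epsilon)
    fix e :: real assume "e > 0"
    obtain \<delta> where \<delta>: "\<delta> > 0" "\<And>y. norm (y - x) < \<delta> \<Longrightarrow>
        norm (infdist y A - infdist x A - D (y - x)) \<le> (e / norm h) * norm (y - x)"
      using D \<open>e > 0\<close> False unfolding has_derivative_at_alt by (metis divide_pos_pos zero_less_norm_iff)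
    define t where "t = \<delta> / (2 * norm h)"
    have t: "t > 0" "t * norm h < \<delta>" using \<delta> False by (auto simp: t_def field_simps)
    have "norm (infdist (x + t *\<^sub>R h) A - infdist x A - t * D h) \<le> (e / norm h) * (t * norm h)"
      using \<delta>(2)[of "x + t *\<^sub>R h"] t by (simp add: D.scaleR)
    moreover have "(e / norm h) * (t * norm h) = t * e" using False by simp
    moreover have "infdist (x + t *\<^sub>R h) A - infdist x A \<le> t * norm h"
      using infdist_Lipschitz[of "x + t *\<^sub>R h" A x] t by simp
    ultimately have "t * D h \<le> t * (norm h + e)"
      unfolding real_norm_def by (simp add: algebra_simps)
    then show "D h \<le> norm h + e" using t by simp
  qed
qed

text \<open>Near-minimizers of the distance almost norm the derivative, so their directions cluster by
  uniform convexity.\<close>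
lemma near_minimizers_close:
  fixes x :: "'a::real_normed_vector"
  assumes uc: "uniformly_convex_space TYPE('a)"
    and D: "((\<lambda>z. infdist z A) has_derivative D) (at x)" and pos: "infdist x A > 0" and "\<epsilon> > 0"
  obtains \<eta> where "\<eta> > 0"
    "\<And>a b. a \<in> A \<Longrightarrow> b \<in> A \<Longrightarrow> norm (x - a) < infdist x A + \<eta> \<Longrightarrow> norm (x - b) < infdist x A + \<eta>
       \<Longrightarrow> norm (a - b) < \<epsilon>"
proof -
  interpret D: bounded_linear D using D by (rule has_derivative_bounded_linear)
  define d where "d = infdist x A"
  have d: "d > 0" using pos by (simp add: d_def)
  \<comment> \<open>As \<open>norm (x - b) < d + 1\<close>, the angle between the directions
    contributes at most \<open>\<epsilon> / 2\<close>; the difference of the lengths contributes the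
    rest.\<close>
  define \<epsilon>' where "\<epsilon>' = \<epsilon> / (2 * (d + 1))"
  have "\<epsilon>' > 0" using d \<open>\<epsilon> > 0\<close> by (simp add: \<epsilon>'_def)
  obtain \<delta> where \<delta>: "\<delta> > 0"
    "\<And>x y :: 'a. norm x = 1 \<Longrightarrow> norm y = 1 \<Longrightarrow> norm (x + y) > 2 - \<delta> \<Longrightarrow> norm (x - y) < \<epsilon>'"
    using uniformly_convexD[OF uc \<open>\<epsilon>' > 0\<close>] by blast
  obtain \<eta> where \<eta>: "\<eta> > 0"
    "\<And>a. a \<in> A \<Longrightarrow> norm (x - a) < infdist x A + \<eta> \<Longrightarrow> (1 - \<delta> / 3) * norm (x - a) \<le> D (x - a)"
    using infdist_derivative_near[OF D pos, of "\<delta> / 3"] \<delta>(1) by auto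
  show thesis
  proof (rule that[of "min \<eta> (min 1 (\<epsilon> / 2))"])
    show "min \<eta> (min 1 (\<epsilon> / 2)) > 0" using \<eta> \<open>\<epsilon> > 0\<close> by simp
    fix a b
    assume ab: "a \<in> A" "b \<in> A" "norm (x - a) < infdist x A + min \<eta> (min 1 (\<epsilon> / 2))"
      "norm (x - b) < infdist x A + min \<eta> (min 1 (\<epsilon> / 2))"
    define u where "u = (1 / norm (x - a)) *\<^sub>R (x - a)"
    define v where "v = (1 / norm (x - b)) *\<^sub>R (x - b)"
    have ge: "d \<le> norm (x - a)" "d \<le> norm (x - b)"
      using infdist_le[OF ab(1), of x] infdist_le[OF ab(2), of x] by (auto simp: d_def dist_norm)
    then have nz: "norm (x - a) > 0" "norm (x - b) > 0" using d by linarith+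
    have uv: "norm u = 1" "norm v = 1" using nz by (auto simp: u_def v_def)
    have Du: "1 - \<delta> / 3 \<le> D u"
      using \<eta>(2)[OF ab(1)] ab(3) nz unfolding u_def D.scaleR by (simp add: pos_le_divide_eq)
    have Dv: "1 - \<delta> / 3 \<le> D v"
      using \<eta>(2)[OF ab(2)] ab(4) nz unfolding v_def D.scaleR by (simp add: pos_le_divide_eq)
    have "D u + D v \<le> norm (u + v)"
      using infdist_derivative_le[OF D, of "u + v"] by (simp add: D.add)
    then have "norm (u + v) > 2 - \<delta>" using Du Dv \<delta>(1) by linarith
    then have close: "norm (u - v) < \<epsilon>'" using \<delta>(2) uv by blast
    have "a - b = norm (x - b) *\<^sub>R (v - u) + (norm (x - b) - norm (x - a)) *\<^sub>R u"
    proof -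
      have "x - a = norm (x - a) *\<^sub>R u" "x - b = norm (x - b) *\<^sub>R v"
        using nz by (auto simp: u_def v_def)
      then have "a - b = norm (x - b) *\<^sub>R v - norm (x - a) *\<^sub>R u"
        by (simp add: algebra_simps flip: \<open>x - a = _\<close> \<open>x - b = _\<close>)
      then show ?thesis by (simp add: algebra_simps)
    qed
    then have "norm (a - b) \<le> norm (x - b) * norm (v - u) + \<bar>norm (x - b) - norm (x - a)\<bar>"
      using norm_triangle_ineq[of "norm (x - b) *\<^sub>R (v - u)" "(norm (x - b) - norm (x - a)) *\<^sub>R u"] uv
      by simp
    moreover have "norm (x - b) * norm (v - u) \<le> (d + 1) * \<epsilon>'"
      using ab(4) close d by (intro mult_mono) (auto simp: d_def norm_minus_commute)
    moreover have "(d + 1) * \<epsilon>' = \<epsilon> / 2" using d by (simp add: \<epsilon>'_def field_simps)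
    moreover have "\<bar>norm (x - b) - norm (x - a)\<bar> < \<epsilon> / 2"
      using ge ab(3,4) unfolding d_def by linarith
    ultimately show "norm (a - b) < \<epsilon>" by linarith
  qed
qed

section \<open>The metric projection onto a set with differentiable distance\<close>

locale differentiable_tube =
  fixes A :: "'a::banach set" and R :: real
  assumes uc: "uniformly_convex_space TYPE('a)" and closed: "closed A" and nonempty: "A \<noteq> {}"
    and diff: "\<And>x. 0 < infdist x A \<Longrightarrow> infdist x A < R \<Longrightarrow>
      \<exists>D. ((\<lambda>z. infdist z A) has_derivative D) (at x)"
begin

text \<open>Adds the points at distance zero from \<open>A\<close>, where the triangle inequality
  suffices.\<close>

lemma minimizers_close:
  assumes "infdist x A < R" "\<epsilon> > 0"
  obtains \<eta> where "\<eta> > 0"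
    "\<And>a b. a \<in> A \<Longrightarrow> b \<in> A \<Longrightarrow> norm (x - a) < infdist x A + \<eta> \<Longrightarrow> norm (x - b) < infdist x A + \<eta>
       \<Longrightarrow> norm (a - b) < \<epsilon>"
proof (cases "infdist x A = 0")
  case True
  show thesis
  proof (rule that[of "\<epsilon> / 2"])
    fix a b assume "norm (x - a) < infdist x A + \<epsilon> / 2" "norm (x - b) < infdist x A + \<epsilon> / 2"
    moreover have "norm (a - b) \<le> norm (x - b) + norm (x - a)"
      using norm_triangle_ineq4[of "x - b" "x - a"] by (simp add: algebra_simps)
    ultimately show "norm (a - b) < \<epsilon>" using True by simp
  qed (use assms in simp)
next
  case False
  then have "0 < infdist x A" using infdist_nonneg[of x A] by simp
  moreover obtain D where "((\<lambda>z. infdist z A) has_derivative D) (at x)"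
    using diff[OF \<open>0 < infdist x A\<close>] assms by blast
  ultimately show thesis
    using near_minimizers_close[OF uc _ _ \<open>\<epsilon> > 0\<close>] that by blast
qed

text \<open>Minimizing sequences are Cauchy by the clustering of near-minimizers, and closedness
  puts their limit into \<open>A\<close>. Two minimizers would be arbitrarily close to each
  other.\<close>

lemma metric_projection_unique:
  assumes "infdist x A < R"
  shows "\<exists>!a. a \<in> metric_projection A x"
proof -
  have "\<exists>a\<in>A. dist x a < infdist x A + 1 / real (Suc n)" for n
    by (rule infdist_near[OF nonempty, of "1 / real (Suc n)" x]) auto
  then obtain a where a: "\<And>n. a n \<in> A" "\<And>n. dist x (a n) < infdist x A + 1 / real (Suc n)"
    by metis
  have "Cauchy a"
  proof (rule metric_CauchyI)
    fix e :: real assume "e > 0"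
    obtain \<eta> where \<eta>: "\<eta> > 0" "\<And>a b. a \<in> A \<Longrightarrow> b \<in> A \<Longrightarrow> norm (x - a) < infdist x A + \<eta> \<Longrightarrow>
        norm (x - b) < infdist x A + \<eta> \<Longrightarrow> norm (a - b) < e"
      using minimizers_close[OF assms \<open>e > 0\<close>] by blast
    obtain N where N: "1 / real (Suc N) < \<eta>" using \<eta>(1) nat_approx_posE by blast
    have le: "norm (x - a n) < infdist x A + \<eta>" if "n \<ge> N" for n
    proof -
      have "1 / real (Suc n) \<le> 1 / real (Suc N)" using that by (simp add: frac_le)
      then show ?thesis using a(2)[of n] N unfolding dist_norm by linarith
    qed
    show "\<exists>M. \<forall>m\<ge>M. \<forall>n\<ge>M. dist (a m) (a n) < e"
      using \<eta>(2)[OF a(1) a(1) le le] unfolding dist_norm by blast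
  qed
  then obtain l where l: "a \<longlonglongrightarrow> l" using Cauchy_convergent convergent_def by blast
  have "l \<in> A" using closed_sequentially[OF closed _ l] a by blast
  have "dist x l \<le> infdist x A + 0"
  proof (rule LIMSEQ_le)
    show "(\<lambda>n. dist x (a n)) \<longlonglongrightarrow> dist x l" by (intro tendsto_intros l)
    show "(\<lambda>n. infdist x A + 1 / real (Suc n)) \<longlonglongrightarrow> infdist x A + 0"
      by (intro tendsto_intros LIMSEQ_Suc[OF lim_1_over_n])
    show "\<exists>N. \<forall>n\<ge>N. dist x (a n) \<le> infdist x A + 1 / real (Suc n)"
      using a(2) by (meson less_imp_le)
  qed
  then have "norm (l - x) = infdist x A"
    using infdist_le[OF \<open>l \<in> A\<close>, of x] by (simp add: dist_norm norm_minus_commute)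
  then have l: "l \<in> metric_projection A x" using \<open>l \<in> A\<close> by (simp add: metric_projection_def)
  moreover have "b = c" if "b \<in> metric_projection A x" "c \<in> metric_projection A x" for b c
  proof (rule ccontr)
    assume "b \<noteq> c"
    then obtain \<eta> where \<eta>: "\<eta> > 0" "\<And>a d. a \<in> A \<Longrightarrow> d \<in> A \<Longrightarrow> norm (x - a) < infdist x A + \<eta> \<Longrightarrow>
        norm (x - d) < infdist x A + \<eta> \<Longrightarrow> norm (a - d) < norm (b - c)"
      using minimizers_close[OF assms, of "norm (b - c)"] by auto
    show False
      using \<eta>(2)[of b c] \<eta>(1) that by (auto simp: metric_projection_def norm_minus_commute)
  qed
  ultimately show ?thesis by blast
qed

definition proj :: "'a \<Rightarrow> 'a" where
  "proj x = (THE a. a \<in> metric_projection A x)"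

lemma proj:
  assumes "infdist x A < R"
  shows "proj x \<in> metric_projection A x" "proj x \<in> A" "norm (x - proj x) = infdist x A"
    "a \<in> metric_projection A x \<Longrightarrow> a = proj x"
proof -
  show *: "proj x \<in> metric_projection A x"
    unfolding proj_def by (rule theI') (rule metric_projection_unique[OF assms])
  then show "proj x \<in> A" "norm (x - proj x) = infdist x A"
    by (auto simp: metric_projection_def norm_minus_commute)
  show "a = proj x" if "a \<in> metric_projection A x"
    using * metric_projection_unique[OF assms] that by blast
qed

text \<open>For \<open>y\<close> close to \<open>x\<close>, the point \<open>proj y\<close> is a
  near-minimizer for \<open>x\<close> and hence clusters with \<open>proj x\<close>.\<close>

lemma continuous_on_proj: "continuous_on {x. infdist x A < R} proj"
  unfolding continuous_on_iff
proof (intro ballI allI impI)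
  fix x and e :: real assume x: "x \<in> {x. infdist x A < R}" and "e > 0"
  then obtain \<eta> where \<eta>: "\<eta> > 0" "\<And>a b. a \<in> A \<Longrightarrow> b \<in> A \<Longrightarrow> norm (x - a) < infdist x A + \<eta> \<Longrightarrow>
      norm (x - b) < infdist x A + \<eta> \<Longrightarrow> norm (a - b) < e"
    using minimizers_close[of x e] by blast
  show "\<exists>d>0. \<forall>y\<in>{x. infdist x A < R}. dist y x < d \<longrightarrow> dist (proj y) (proj x) < e"
  \<comment> \<open>Half of \<eta>, since \<open>norm (x - y)\<close> is spent twice: in the
    triangle inequality and in comparing the two distances.\<close>
  proof (intro exI[of _ "\<eta> / 2"] conjI ballI impI)
    fix y assume y: "y \<in> {x. infdist x A < R}" "dist y x < \<eta> / 2"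
    have "norm (x - proj y) \<le> norm (x - y) + norm (y - proj y)"
      using norm_triangle_ineq[of "x - y" "y - proj y"] by simp
    also have "\<dots> < infdist x A + \<eta>"
      using y proj(3)[of y] infdist_Lipschitz[of x A y] by (simp add: dist_norm norm_minus_commute)
    finally show "dist (proj y) (proj x) < e"
      unfolding dist_norm using x y proj(2,3)[of x] proj(2)[of y] \<eta>(1)
      by (intro \<eta>(2)) auto
  qed (use \<eta> in simp)
qed

text \<open>Ekeland's principle gives a point from which no further climb at rate \<open>c\<close>
  is possible. Below level \<open>T\<close> such a point cannot exist, because stepping away from a
  near-minimizer climbs at almost unit rate.\<close>

lemma infdist_ascent:
  assumes x: "0 < infdist x A" "infdist x A < T" "T < R" and c: "0 < c" "c < 1"
  obtains y where "T \<le> infdist y A" "c * norm (y - x) \<le> T - infdist x A"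
proof -
  \<comment> \<open>Truncation makes the function bounded above, as Ekeland's principle
    demands.\<close>
  define f where "f z = min (infdist z A) T" for z
  have "continuous_on UNIV f"
    unfolding f_def by (intro continuous_intros continuous_on_infdist)
  then obtain y where y: "f x + c * dist y x \<le> f y" "\<And>z. f y + c * dist z y \<le> f z \<Longrightarrow> z = y"
    by (rule ekeland_maximum[of f T c x]) (use c in \<open>auto simp: f_def\<close>)
  have fy: "infdist x A + c * norm (y - x) \<le> f y" using y(1) x by (simp add: f_def dist_norm)
  have "T \<le> infdist y A"
  proof (rule ccontr)
    assume "\<not> T \<le> infdist y A"
    then have lt: "infdist y A < T" by simp
    have "0 \<le> c * norm (y - x)" using c by simp
    then have pos: "0 < infdist y A" using fy x lt by (simp add: f_def)
    obtain D where D: "((\<lambda>z. infdist z A) has_derivative D) (at y)"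
      using diff[of y] pos lt x by auto
    interpret D: bounded_linear D using D by (rule has_derivative_bounded_linear)
    \<comment> \<open>Slope \<open>1 - \<epsilon>\<close> minus expansion error \<epsilon> leaves
      exactly \<open>c\<close>.\<close>
    define \<epsilon> where "\<epsilon> = (1 - c) / 2"
    have \<epsilon>: "\<epsilon> > 0" using c by (simp add: \<epsilon>_def)
    obtain \<eta> where \<eta>: "\<eta> > 0"
      "\<And>a. a \<in> A \<Longrightarrow> norm (y - a) < infdist y A + \<eta> \<Longrightarrow> (1 - \<epsilon>) * norm (y - a) \<le> D (y - a)"
      using infdist_derivative_near[OF D pos \<epsilon>] by blast
    obtain a where a: "a \<in> A" "dist y a < infdist y A + \<eta>"
      using infdist_near[OF nonempty \<eta>(1)] by blast
    define v where "v = y - a"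
    have v: "(1 - \<epsilon>) * norm v \<le> D v" using \<eta>(2)[OF a(1)] a(2) by (simp add: v_def dist_norm)
    have nv: "norm v > 0"
      using infdist_le[OF a(1), of y] pos unfolding v_def dist_norm by linarith
    obtain \<delta> where \<delta>: "\<delta> > 0" "\<And>z. norm (z - y) < \<delta> \<Longrightarrow>
        norm (infdist z A - infdist y A - D (z - y)) \<le> \<epsilon> * norm (z - y)"
      using D \<epsilon> unfolding has_derivative_at_alt by blast
    \<comment> \<open>The first bound stays in the range of the expansion; the second keeps the
      distance at \<open>z\<close> below \<open>T\<close>, so that the truncation is
      inactive.\<close>
    define h where "h = min (\<delta> / 2) (T - infdist y A)"
    have h: "0 < h" "h < \<delta>" "h \<le> T - infdist y A" using \<delta>(1) lt by (auto simp: h_def)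
    define z where "z = y + (h / norm v) *\<^sub>R v"
    have zy: "z - y = (h / norm v) *\<^sub>R v" "norm (z - y) = h" using h nv by (auto simp: z_def)
    have "(h / norm v) * ((1 - \<epsilon>) * norm v) \<le> D (z - y)"
      unfolding zy(1) D.scaleR real_scaleR_def using v h nv by (intro mult_left_mono) auto
    then have "(1 - \<epsilon>) * h \<le> D (z - y)" using nv by (simp add: mult.commute)
    moreover have "norm (infdist z A - infdist y A - D (z - y)) \<le> \<epsilon> * h"
      using \<delta>(2)[of z] h zy by simp
    moreover have "(1 - \<epsilon>) * h - \<epsilon> * h = c * h" by (simp add: \<epsilon>_def algebra_simps)
    ultimately have "infdist y A + c * h \<le> infdist z A" unfolding real_norm_def by linarith
    moreover have "infdist z A \<le> T" using infdist_Lipschitz[of z A y] zy h by linarith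
    ultimately have "f y + c * dist z y \<le> f z" using lt zy by (simp add: f_def dist_norm)
    then have "z = y" by (rule y(2))
    then show False using zy h by simp
  qed
  moreover have "c * norm (y - x) \<le> T - infdist x A" using fy by (simp add: f_def)
  ultimately show thesis by (rule that)
qed

text \<open>A point that gains almost as much distance from \<open>A\<close> as it moves must, by uniform convexity,
  move almost straight away from the projection.\<close>
lemma infdist_normal_ray:
  assumes x: "0 < infdist x A" "infdist x A < T" "T < R"
  shows "T \<le> infdist (proj x + (T / infdist x A) *\<^sub>R (x - proj x)) A"
proof (rule field_le_epsilon)
  fix e :: real assume "e > 0"
  define d where "d = infdist x A"
  define \<tau> where "\<tau> = T - d"
  define n where "n = (1 / d) *\<^sub>R (x - proj x)"
  have d: "d > 0" "\<tau> > 0" using x by (auto simp: d_def \<tau>_def)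
  have xp: "x - proj x = d *\<^sub>R n" "norm n = 1" using d proj(3)[of x] x by (auto simp: n_def d_def)
  define \<epsilon> where "\<epsilon> = e / (2 * \<tau>)"
  have \<epsilon>: "\<epsilon> > 0" "\<tau> * \<epsilon> = e / 2" using d \<open>e > 0\<close> by (auto simp: \<epsilon>_def)
  obtain \<delta> where \<delta>: "\<delta> > 0"
    "\<And>x y :: 'a. norm x = 1 \<Longrightarrow> norm y = 1 \<Longrightarrow> norm (x + y) > 2 - \<delta> \<Longrightarrow> norm (x - y) < \<epsilon>"
    using uniformly_convexD[OF uc \<epsilon>(1)] by blast
  define \<mu> where "\<mu> = min \<tau> d"
  \<comment> \<open>\<open>k\<close> is the excess length allowed to the climb: \<open>e / 2\<close>
    controls the error along the ray, and \<open>\<mu> * \<delta> / 2\<close> forces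
    \<open>norm (w + n) > 2 - \<delta>\<close>.\<close>
  define k where "k = min (e / 2) (\<mu> * \<delta> / 2)"
  have \<mu>: "\<mu> > 0" and k: "k > 0" using d \<delta> \<open>e > 0\<close> by (auto simp: \<mu>_def k_def)
  \<comment> \<open>With this rate the ascent bound becomes
    \<open>\<tau>' \<le> \<tau> + k\<close>.\<close>
  define c where "c = \<tau> / (\<tau> + k)"
  have c: "0 < c" "c < 1" using d k by (auto simp: c_def)
  obtain y where y: "T \<le> infdist y A" "c * norm (y - x) \<le> T - infdist x A"
    using infdist_ascent[OF x c] by blast
  define \<tau>' where "\<tau>' = norm (y - x)"
  define w where "w = (1 / \<tau>') *\<^sub>R (y - x)"
  have "\<tau> * \<tau>' \<le> \<tau> * (\<tau> + k)"
    using y(2) d k by (simp add: c_def \<tau>'_def \<tau>_def d_def pos_divide_le_eq)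
  then have up: "\<tau>' \<le> \<tau> + k" using d by simp
  have low: "\<tau> \<le> \<tau>'" using infdist_Lipschitz[of y A x] y(1) by (simp add: \<tau>_def \<tau>'_def d_def)
  have yx: "y - x = \<tau>' *\<^sub>R w" "norm w = 1" using low d by (auto simp: w_def \<tau>'_def)
  have "T \<le> norm (y - proj x)"
    using infdist_le[of "proj x" A y] proj(2)[of x] x y(1) by (simp add: dist_norm)
  \<comment> \<open>Splitting off the common length \<mu> isolates the sum of the two unit
    directions; the remainders are estimated by their lengths.\<close>
  also have "y - proj x = \<mu> *\<^sub>R (w + n) + ((\<tau>' - \<mu>) *\<^sub>R w + (d - \<mu>) *\<^sub>R n)"
  proof -
    have "y - proj x = (y - x) + (x - proj x)" by simp
    then show ?thesis unfolding yx(1) xp(1) by (simp add: algebra_simps)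
  qed
  also have "norm \<dots> \<le> \<mu> * norm (w + n) + ((\<tau>' - \<mu>) + (d - \<mu>))"
  proof -
    have "norm ((\<tau>' - \<mu>) *\<^sub>R w + (d - \<mu>) *\<^sub>R n) \<le> (\<tau>' - \<mu>) + (d - \<mu>)"
      using norm_triangle_ineq[of "(\<tau>' - \<mu>) *\<^sub>R w" "(d - \<mu>) *\<^sub>R n"] yx xp low by (simp add: \<mu>_def)
    then show ?thesis
      using norm_triangle_ineq[of "\<mu> *\<^sub>R (w + n)" "(\<tau>' - \<mu>) *\<^sub>R w + (d - \<mu>) *\<^sub>R n"] \<mu> by simp
  qed
  finally have "\<mu> * (2 - \<delta> / 2) \<le> \<mu> * norm (w + n)"
    using up by (simp add: \<tau>_def k_def algebra_simps)
  then have "norm (w + n) \<ge> 2 - \<delta> / 2" using \<mu> by simp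
  then have wn: "norm (w - n) < \<epsilon>" using \<delta> yx xp by simp
  define z where "z = proj x + (T / infdist x A) *\<^sub>R (x - proj x)"
  have "y - z = (\<tau>' - \<tau>) *\<^sub>R w + \<tau> *\<^sub>R (w - n)"
  proof -
    have "z = x + \<tau> *\<^sub>R n"
    proof -
      have "z = proj x + T *\<^sub>R n" by (simp add: z_def n_def d_def)
      also have "\<dots> = proj x + d *\<^sub>R n + \<tau> *\<^sub>R n" by (simp add: \<tau>_def algebra_simps)
      also have "\<dots> = x + \<tau> *\<^sub>R n" by (simp flip: xp(1))
      finally show ?thesis .
    qed
    then have "y - z = (y - x) - \<tau> *\<^sub>R n" by simp
    then show ?thesis unfolding yx(1) by (simp add: algebra_simps)
  qed
  then have "norm (y - z) \<le> (\<tau>' - \<tau>) + \<tau> * norm (w - n)"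
    using norm_triangle_ineq[of "(\<tau>' - \<tau>) *\<^sub>R w" "\<tau> *\<^sub>R (w - n)"] low d yx by simp
  also have "\<dots> \<le> k + \<tau> * \<epsilon>"
    using up wn d by (intro add_mono mult_left_mono) auto
  also have "\<dots> \<le> e" using \<epsilon> by (simp add: k_def)
  finally show "T \<le> infdist (proj x + (T / infdist x A) *\<^sub>R (x - proj x)) A + e"
    using infdist_Lipschitz[of y A z] y(1) unfolding z_def by linarith
qed

end

lemma proximally_smooth_differentiable_tube:
  fixes A :: "'a::banach set"
  assumes "uniformly_convex_space TYPE('a)" "proximally_smooth R A" "A \<noteq> {}"
  shows "differentiable_tube A R"
  using assms unfolding differentiable_tube_def proximally_smooth_def by blast

section \<open>Smoothness of the norm and slice-projections\<close>

lemma minus_midpoint: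
  fixes u v :: "'a::real_normed_vector"
  shows "u - midpoint u v = (1 / 2) *\<^sub>R (u - v)" "v - midpoint u v = - ((1 / 2) *\<^sub>R (u - v))"
proof -
  have "u = (1 / 2) *\<^sub>R u + (1 / 2) *\<^sub>R u" "v = (1 / 2) *\<^sub>R v + (1 / 2) *\<^sub>R v"
    by (auto simp flip: scaleR_left_distrib)
  moreover have "midpoint u v = (1 / 2) *\<^sub>R u + (1 / 2) *\<^sub>R v"
    by (simp add: midpoint_def scaleR_right_distrib)
  ultimately show "u - midpoint u v = (1 / 2) *\<^sub>R (u - v)"
    "v - midpoint u v = - ((1 / 2) *\<^sub>R (u - v))"
    by (metis add_diff_cancel_left scaleR_right_diff_distrib add.commute,
      metis add_diff_cancel_left scaleR_right_diff_distrib add.commute minus_diff_eq)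
qed

section \<open>One-sided derivatives of the norm and the supporting functional\<close>

definition norm_quotient :: "'a::real_normed_vector \<Rightarrow> 'a \<Rightarrow> real \<Rightarrow> real" where
  "norm_quotient x y t = (norm (x + t *\<^sub>R y) - norm x) / t"

text \<open>The right derivative of the norm at \<open>x\<close> along \<open>y\<close>: the
  quotient is monotone in \<open>t\<close>, so its infimum is the limit at \<open>0\<close>. In a
  smooth space it is the supporting functional, obtained without an extension argument.\<close>

definition norm_derivative :: "'a::real_normed_vector \<Rightarrow> 'a \<Rightarrow> real" where
  "norm_derivative x y = Inf (norm_quotient x y ` {0<..})"

lemma norm_quotient_ge: "0 < t \<Longrightarrow> - norm y \<le> norm_quotient x y t"
  using norm_triangle_ineq4[of "x + t *\<^sub>R y" "t *\<^sub>R y"] by (simp add: norm_quotient_def pos_le_divide_eq mult.commute)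

text \<open>Convexity of the norm: \<open>x + r *\<^sub>R y\<close> is a convex combination of
  \<open>x\<close> and \<open>x + t *\<^sub>R y\<close>.\<close>

lemma norm_quotient_mono:
  assumes "0 < r" "r \<le> t"
  shows "norm_quotient x y r \<le> norm_quotient x y t"
proof -
  define l where "l = r / t"
  have l: "0 < l" "l \<le> 1" "r = l * t" using assms by (auto simp: l_def)
  have "x + r *\<^sub>R y = (1 - l) *\<^sub>R x + l *\<^sub>R (x + t *\<^sub>R y)"
    by (simp add: l(3) algebra_simps)
  then have "norm (x + r *\<^sub>R y) \<le> (1 - l) * norm x + l * norm (x + t *\<^sub>R y)"
    using norm_triangle_ineq[of "(1 - l) *\<^sub>R x" "l *\<^sub>R (x + t *\<^sub>R y)"] l by simp
  then have "norm (x + r *\<^sub>R y) - norm x \<le> l * (norm (x + t *\<^sub>R y) - norm x)"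
    by (simp add: algebra_simps)
  then show ?thesis using assms unfolding norm_quotient_def l_def
    by (simp add: field_simps)
qed

lemma norm_derivative_le: "0 < t \<Longrightarrow> norm_derivative x y \<le> norm_quotient x y t"
  unfolding norm_derivative_def
  by (intro cInf_lower bdd_belowI[of _ "- norm y"]) (auto intro: norm_quotient_ge)

lemma norm_derivative_ge:
  "(\<And>t. 0 < t \<Longrightarrow> m \<le> norm_quotient x y t) \<Longrightarrow> m \<le> norm_derivative x y"
  unfolding norm_derivative_def by (intro cInf_greatest) auto

lemma norm_derivative_approx:
  assumes "0 < e"
  obtains t where "0 < t" "\<And>r. 0 < r \<Longrightarrow> r \<le> t \<Longrightarrow> norm_quotient x y r < norm_derivative x y + e"
proof -
  obtain t where t: "0 < t" "norm_quotient x y t < norm_derivative x y + e"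
    using norm_derivative_ge[of "norm_derivative x y + e" x y] assms by force
  show thesis
    by (rule that[OF t(1)]) (rule le_less_trans[OF norm_quotient_mono t(2)])
qed

text \<open>The midpoint of \<open>x + t *\<^sub>R y\<close> and \<open>x + t *\<^sub>R z\<close> is
  \<open>x + (t / 2) *\<^sub>R (y + z)\<close>; monotonicity lets one small \<open>t\<close> serve
  both directions.\<close>

lemma norm_derivative_subadditive:
  "norm_derivative x (y + z) \<le> norm_derivative x y + norm_derivative x z"
proof (rule field_le_epsilon)
  fix e :: real assume "0 < e"
  obtain t1 where t1: "0 < t1" "\<And>r. 0 < r \<Longrightarrow> r \<le> t1 \<Longrightarrow> norm_quotient x y r < norm_derivative x y + e / 2"
    using norm_derivative_approx[of "e / 2"] \<open>0 < e\<close> by (meson half_gt_zero)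
  obtain t2 where t2: "0 < t2" "\<And>r. 0 < r \<Longrightarrow> r \<le> t2 \<Longrightarrow> norm_quotient x z r < norm_derivative x z + e / 2"
    using norm_derivative_approx[of "e / 2"] \<open>0 < e\<close> by (meson half_gt_zero)
  define t where "t = min t1 t2"
  have t: "0 < t" using t1 t2 by (simp add: t_def)
  have "2 *\<^sub>R (x + (t / 2) *\<^sub>R (y + z)) = (x + t *\<^sub>R y) + (x + t *\<^sub>R z)"
    by (simp add: algebra_simps scaleR_2)
  then have "2 * norm (x + (t / 2) *\<^sub>R (y + z)) \<le> norm (x + t *\<^sub>R y) + norm (x + t *\<^sub>R z)"
    using norm_triangle_ineq[of "x + t *\<^sub>R y" "x + t *\<^sub>R z"] by (metis norm_scaleR abs_numeral)
  then have "norm_quotient x (y + z) (t / 2) \<le> norm_quotient x y t + norm_quotient x z t"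
    using t unfolding norm_quotient_def by (simp add: diff_divide_distrib flip: add_divide_distrib)
      (simp add: divide_right_mono mult.commute)
  moreover have "norm_derivative x (y + z) \<le> norm_quotient x (y + z) (t / 2)"
    using t by (intro norm_derivative_le) auto
  moreover have "norm_quotient x y t < norm_derivative x y + e / 2" "norm_quotient x z t < norm_derivative x z + e / 2"
    using t t1 t2 by (auto simp: t_def)
  ultimately show "norm_derivative x (y + z) \<le> norm_derivative x y + norm_derivative x z + e" by linarith
qed

lemma norm_derivative_le_norm: "norm_derivative x y \<le> norm y"
  using norm_derivative_le[of 1 x y] norm_triangle_ineq[of x y] by (simp add: norm_quotient_def)

lemma norm_derivative_self: "norm_derivative x x = norm x"
proof (rule antisym[OF norm_derivative_le_norm], rule norm_derivative_ge)
  fix t :: real assume "0 < t"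
  then have "norm (x + t *\<^sub>R x) = (1 + t) * norm x"
    by (metis abs_of_pos add_pos_pos norm_scaleR scaleR_left_distrib scaleR_one zero_less_one)
  then show "norm x \<le> norm_quotient x x t" using \<open>0 < t\<close> by (simp add: norm_quotient_def algebra_simps)
qed

lemma norm_derivative_scale_le:
  assumes "0 < c"
  shows "norm_derivative x (c *\<^sub>R y) \<le> c * norm_derivative x y"
proof -
  have "norm_derivative x (c *\<^sub>R y) / c \<le> norm_derivative x y"
  proof (rule norm_derivative_ge)
    fix t :: real assume "0 < t"
    then have "norm_derivative x (c *\<^sub>R y) \<le> norm_quotient x (c *\<^sub>R y) (t / c)"
      using assms by (intro norm_derivative_le) auto
    also have "\<dots> = c * norm_quotient x y t" using assms by (simp add: norm_quotient_def)
    finally show "norm_derivative x (c *\<^sub>R y) / c \<le> norm_quotient x y t"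
      using assms by (simp add: pos_divide_le_eq mult.commute)
  qed
  then show ?thesis using assms by (simp add: pos_divide_le_eq mult.commute)
qed

text \<open>The bound on the modulus of smoothness in homogeneous form, rescaled from the unit
  sphere to arbitrary non-zero \<open>x\<close>.\<close>

locale power_smooth =
  fixes type :: "'a::real_normed_vector itself" and C s :: real
  assumes C: "0 < C" and s: "1 < s"
    and smooth: "\<And>x y :: 'a. x \<noteq> 0 \<Longrightarrow>
      norm (x + y) + norm (x - y) \<le> 2 * norm x + 2 * norm x * (C * (norm y / norm x) powr s)"
begin

text \<open>The quotients along \<open>y\<close> and \<open>- y\<close> add up to a second
  difference divided by \<open>t\<close>, which smoothness makes of order
  \<open>t powr (s - 1)\<close>. The reverse inequality is subadditivity.\<close>

lemma norm_derivative_minus: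
  fixes x y :: 'a
  assumes "x \<noteq> 0"
  shows "norm_derivative x (- y) = - norm_derivative x y"
proof -
  have "norm_derivative x y + norm_derivative x (- y) \<le> 0"
  proof (rule field_le_epsilon)
    fix e :: real assume e: "0 < e"
    define K where "K = 2 * norm x * (C * (norm y / norm x) powr s)"
    have K: "0 \<le> K" using C by (simp add: K_def)
    \<comment> \<open>Solves \<open>t powr (s - 1) = e / (K + 1)\<close>; adding one keeps the
      denominator positive when \<open>K\<close> vanishes.\<close>
    define t where "t = (e / (K + 1)) powr (1 / (s - 1))"
    have t: "0 < t" using e K by (simp add: t_def)
    have ts: "t powr (s - 1) = e / (K + 1)" using e K s by (simp add: t_def powr_powr)
    have "norm_quotient x y t + norm_quotient x (- y) t
        = (norm (x + t *\<^sub>R y) + norm (x - t *\<^sub>R y) - 2 * norm x) / t"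
      by (simp add: norm_quotient_def add_divide_distrib diff_divide_distrib)
    also have "\<dots> \<le> 2 * norm x * (C * (norm (t *\<^sub>R y) / norm x) powr s) / t"
      using smooth[OF assms, of "t *\<^sub>R y"] t by (intro divide_right_mono) auto
    also have "(norm (t *\<^sub>R y) / norm x) powr s = (norm y / norm x) powr s * t powr s"
    proof -
      have "norm (t *\<^sub>R y) / norm x = (norm y / norm x) * t" using t by simp
      then show ?thesis using t by (simp only: powr_mult)
    qed
    also have "2 * norm x * (C * ((norm y / norm x) powr s * t powr s)) / t = K * t powr (s - 1)"
      using t by (simp add: K_def powr_diff)
    also have "\<dots> \<le> e" unfolding ts using e K by (simp add: pos_divide_le_eq)
    finally show "norm_derivative x y + norm_derivative x (- y) \<le> 0 + e"
      using norm_derivative_le[OF t, of x y] norm_derivative_le[OF t, of x "- y"] by linarith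
  qed
  moreover have "0 \<le> norm_derivative x 0"
    by (rule norm_derivative_ge) (simp add: norm_quotient_def)
  ultimately show ?thesis using norm_derivative_subadditive[of x y "- y"] by simp
qed

text \<open>Subadditivity for \<open>y, z\<close> and for \<open>- y, - z\<close> combines with
  oddness into additivity.\<close>

lemma bounded_linear_norm_derivative:
  fixes x :: 'a
  assumes "x \<noteq> 0"
  shows "bounded_linear (norm_derivative x)"
proof (rule bounded_linear_intro[where K = 1])
  note minus = norm_derivative_minus[OF assms]
  show "norm_derivative x (y + z) = norm_derivative x y + norm_derivative x z" for y z
    using norm_derivative_subadditive[of x y z] norm_derivative_subadditive[of x "- y" "- z"]
      minus[of y] minus[of z] minus[of "y + z"] by simp
  have pos: "norm_derivative x (c *\<^sub>R y) = c * norm_derivative x y" if "0 < c" for c y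
  proof (rule antisym[OF norm_derivative_scale_le[OF that]])
    have "norm_derivative x ((1 / c) *\<^sub>R (c *\<^sub>R y)) \<le> (1 / c) * norm_derivative x (c *\<^sub>R y)"
      using that by (intro norm_derivative_scale_le) auto
    then show "c * norm_derivative x y \<le> norm_derivative x (c *\<^sub>R y)"
      using that by (simp add: field_simps)
  qed
  show "norm_derivative x (c *\<^sub>R y) = c *\<^sub>R norm_derivative x y" for c y
  proof (cases c "0 :: real" rule: linorder_cases)
    case less
    have "norm_derivative x (c *\<^sub>R y) = norm_derivative x (- ((- c) *\<^sub>R y))" by simp
    also have "\<dots> = c * norm_derivative x y" unfolding minus using pos[of "- c" y] less by simp
    finally show ?thesis by simp
  next
    case equal
    then show ?thesis using minus[of 0] by simp
  qed (use pos in simp)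
  show "norm (norm_derivative x y) \<le> norm y * 1" for y
    using norm_derivative_le_norm[of x y] norm_derivative_le_norm[of x "- y"] minus[of y]
    by simp
qed

text \<open>The derivative of the norm is one such functional. Any other is dominated by the
  difference quotients, hence by the derivative, and oddness turns domination into equality; so the
  definite description is meaningful.\<close>

lemma supporting_functional:
  fixes x :: 'a
  assumes "x \<noteq> 0"
  shows "norm (supporting_functional x) = 1" "blinfun_apply (supporting_functional x) x = norm x"
proof -
  define p where "p = Blinfun (norm_derivative x)"
  have p: "blinfun_apply p y = norm_derivative x y" for y
    unfolding p_def using bounded_linear_norm_derivative[OF assms] by (simp add: bounded_linear_Blinfun_apply)
  have px: "blinfun_apply p x = norm x" by (simp add: p norm_derivative_self)
  have "norm p \<le> 1"
  proof (rule norm_blinfun_bound)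
    show "norm (blinfun_apply p y) \<le> 1 * norm y" for y
      unfolding p using norm_derivative_le_norm[of x y] norm_derivative_le_norm[of x "- y"]
        norm_derivative_minus[OF assms, of y] by simp
  qed simp
  moreover have "1 \<le> norm p" using norm_blinfun[of p x] px assms by simp
  ultimately have np: "norm p = 1" by simp
  have "q = p" if "norm q = 1" "blinfun_apply q x = norm x" for q :: "'a \<Rightarrow>\<^sub>L real"
  proof (rule blinfun_eqI)
    have le: "blinfun_apply q y \<le> norm_derivative x y" for y
    proof (rule norm_derivative_ge)
      fix t :: real assume "0 < t"
      have "blinfun_apply q (x + t *\<^sub>R y) \<le> norm (x + t *\<^sub>R y)"
        using norm_blinfun[of q "x + t *\<^sub>R y"] that(1) by simp
      then show "blinfun_apply q y \<le> norm_quotient x y t"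
        using \<open>0 < t\<close> that(2)
        by (simp add: norm_quotient_def blinfun.add_right blinfun.scaleR_right pos_le_divide_eq mult.commute)
    qed
    show "blinfun_apply q y = blinfun_apply p y" for y
      using le[of y] le[of "- y"] norm_derivative_minus[OF assms, of y] by (simp add: p blinfun.minus_right)
  qed
  then have "\<exists>!p. norm p = 1 \<and> blinfun_apply p x = norm x" using np px by blast
  from theI'[OF this] show "norm (supporting_functional x) = 1"
    "blinfun_apply (supporting_functional x) x = norm x"
    unfolding supporting_functional_def by auto
qed

lemma supporting_functional_le:
  fixes x :: 'a
  assumes "x \<noteq> 0"
  shows "\<bar>blinfun_apply (supporting_functional x) y\<bar> \<le> norm y"
  using norm_blinfun[of "supporting_functional x" y] supporting_functional(1)[OF assms] by simp

text \<open>Bound \<open>norm (x - y)\<close> in the smoothness inequality from below by the value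
  of the supporting functional at \<open>x - y\<close>.\<close>

lemma norm_add_le:
  fixes x y :: 'a
  assumes "x \<noteq> 0"
  shows "norm (x + y) \<le> norm x + blinfun_apply (supporting_functional x) y
    + 2 * norm x * (C * (norm y / norm x) powr s)"
  using smooth[OF assms, of y] supporting_functional_le[OF assms, of "x - y"]
    supporting_functional(2)[OF assms] by (simp add: blinfun.diff_right)

text \<open>The linear terms of the expansion cancel because the weighted mean of \<open>y\<close>
  and \<open>z\<close> is zero; only the smoothness error survives.\<close>

lemma norm_convex_combination_le:
  fixes x y z :: 'a
  assumes "x \<noteq> 0" "0 \<le> l" "l \<le> 1" "(1 - l) *\<^sub>R y + l *\<^sub>R z = 0" "norm y \<le> N" "norm z \<le> N"
  shows "(1 - l) * norm (x + y) + l * norm (x + z) \<le> norm x + 2 * norm x * (C * (N / norm x) powr s)"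
proof -
  define p where "p = blinfun_apply (supporting_functional x)"
  define E where "E = 2 * norm x * (C * (N / norm x) powr s)"
  have bound: "norm (x + w) \<le> norm x + p w + E" if "norm w \<le> N" for w
  proof -
    have "(norm w / norm x) powr s \<le> (N / norm x) powr s"
      using that s by (intro powr_mono2 divide_right_mono) auto
    then have "2 * norm x * (C * (norm w / norm x) powr s) \<le> E"
      using C unfolding E_def by (intro mult_left_mono) auto
    then show ?thesis using norm_add_le[OF assms(1), of w] by (simp add: p_def)
  qed
  have "(1 - l) * norm (x + y) + l * norm (x + z)
      \<le> (1 - l) * (norm x + p y + E) + l * (norm x + p z + E)"
    using assms by (intro add_mono mult_left_mono bound) auto
  also have "\<dots> = norm x + E + p ((1 - l) *\<^sub>R y + l *\<^sub>R z)"
    unfolding p_def blinfun.add_right blinfun.scaleR_right by (simp add: algebra_simps)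
  also have "\<dots> = norm x + E" unfolding assms(4) by (simp add: p_def)
  finally show ?thesis by (simp add: E_def)
qed

end

lemma smoothness_of_power_type_power_smooth:
  assumes "smoothness_of_power_type TYPE('a::real_normed_vector) s" "1 < s"
  obtains C where "power_smooth TYPE('a) C s"
proof -
  obtain C where C: "\<And>t. 0 \<le> t \<Longrightarrow> modulus_of_smoothness TYPE('a) t \<le> C * t powr s"
    using assms unfolding smoothness_of_power_type_def by blast
  show thesis
  \<comment> \<open>The given constant may fail to be positive; enlarging it is harmless.\<close>
  proof (rule that[of "max C 1"], unfold_locales)
    fix x y :: 'a assume "x \<noteq> 0"
    define u where "u = (1 / norm x) *\<^sub>R x"
    define v where "v = (1 / norm x) *\<^sub>R y"
    have u: "norm u = 1" "norm v = norm y / norm x" using \<open>x \<noteq> 0\<close> by (auto simp: u_def v_def)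
    have xy: "x = norm x *\<^sub>R u" "y = norm x *\<^sub>R v" using \<open>x \<noteq> 0\<close> by (auto simp: u_def v_def)
    have "(norm (u + v) + norm (u - v)) / 2 - 1 \<le> modulus_of_smoothness TYPE('a) (norm v)"
      unfolding modulus_of_smoothness_def
    proof (rule cSup_upper)
      \<comment> \<open>Boundedness makes \<open>Sup\<close> a genuine supremum rather than an
        unspecified value.\<close>
      show "bdd_above {(norm (x + y) + norm (x - y)) / 2 - 1 |x y :: 'a. norm x = 1 \<and> norm y = norm v}"
      proof (rule bdd_aboveI[of _ "norm v"], clarify)
        fix x y :: 'a assume "norm x = 1" "norm y = norm v"
        then have "norm (x + y) \<le> 1 + norm v" "norm (x - y) \<le> 1 + norm v"
          using norm_triangle_ineq[of x y] norm_triangle_ineq4[of x y] by auto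
        then have "norm (x + y) + norm (x - y) \<le> 2 + 2 * norm v" by linarith
        then show "(norm (x + y) + norm (x - y)) / 2 - 1 \<le> norm v"
          unfolding diff_le_eq by (subst pos_divide_le_eq) (auto simp: algebra_simps)
      qed
    qed (use u in blast)
    also have "\<dots> \<le> C * norm v powr s" by (rule C) simp
    also have "\<dots> \<le> max C 1 * norm v powr s" by (intro mult_right_mono) auto
    finally have "norm (u + v) + norm (u - v) \<le> 2 + 2 * (max C 1 * norm v powr s)"
      unfolding diff_le_eq by (subst (asm) pos_divide_le_eq) (auto simp: algebra_simps)
    then have "norm x * (norm (u + v) + norm (u - v)) \<le> norm x * (2 + 2 * (max C 1 * norm v powr s))"
      by (rule mult_left_mono) simp
    moreover have "norm (x + y) = norm x * norm (u + v)" "norm (x - y) = norm x * norm (u - v)"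
      using xy by (metis norm_scaleR abs_norm_cancel scaleR_right_distrib,
        metis norm_scaleR abs_norm_cancel scaleR_right_diff_distrib)
    ultimately show "norm (x + y) + norm (x - y)
        \<le> 2 * norm x + 2 * norm x * (max C 1 * (norm y / norm x) powr s)"
      unfolding u by (simp add: algebra_simps)
  qed (use assms in auto)
qed

section \<open>Depth of chords, and existence and location of slice-projections\<close>

locale smooth_tube = differentiable_tube A R + power_smooth "TYPE('a)" C s
  for A :: "'a::banach set" and R C s
begin

text \<open>The open ball of radius \<open>R / 2\<close> touching \<open>A\<close> at the projection of \<open>x\<close> avoids both endpoints of
  the segment; smoothness of the norm at the centre bounds how far the segment can enter it.\<close>
lemma infdist_segment_le:
  assumes uv: "u \<in> A" "v \<in> A" "norm (u - v) \<le> R / 2" and x: "x \<in> closed_segment u v"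
  shows "infdist x A \<le> 2 * C * 4 powr (s - 1) * (norm (u - v) * (norm (u - v) / R) powr (s - 1))"
proof (cases "infdist x A = 0")
  case True
  then show ?thesis using C norm_ge_zero[of "u - v"] by (simp del: norm_ge_zero)
next
  case False
  define d where "d = infdist x A"
  define N where "N = norm (u - v)"
  have d: "0 < d" using False infdist_nonneg[of x A] by (simp add: d_def)
  obtain l where l: "0 \<le> l" "l \<le> 1" "x = (1 - l) *\<^sub>R u + l *\<^sub>R v"
    using x unfolding in_segment by blast
  have ux: "u - x = l *\<^sub>R (u - v)" and vx: "v - x = - ((1 - l) *\<^sub>R (u - v))"
    using l(3) by (auto simp: algebra_simps)
  have nux: "norm (u - x) = l * N" and nvx: "norm (v - x) = (1 - l) * N"
    unfolding ux vx using l by (auto simp: N_def)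
  have N: "0 \<le> N" "N \<le> R / 2" using uv by (auto simp: N_def)
  have "d \<le> l * N" "d \<le> (1 - l) * N"
    using infdist_le[OF uv(1), of x] infdist_le[OF uv(2), of x] nux nvx
    by (auto simp: d_def dist_norm norm_minus_commute)
  then have "2 * d \<le> N" by (simp add: algebra_simps)
  then have dR: "d \<le> R / 4" and R: "0 < R" using N d by auto
  \<comment> \<open>Centre of the touching ball on the normal ray through \<open>x\<close>. As
    \<open>d \<le> R / 4\<close>, it lies beyond \<open>x\<close>, at distance at least
    \<open>R / 4\<close> from it.\<close>
  define c where "c = proj x + (R / 2 / d) *\<^sub>R (x - proj x)"
  have c: "R / 2 \<le> infdist c A"
    unfolding c_def d_def by (rule infdist_normal_ray) (use d dR R in \<open>auto simp: d_def\<close>)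
  define w where "w = x - c"
  have "w = (1 - R / 2 / d) *\<^sub>R (x - proj x)" by (simp add: w_def c_def algebra_simps)
  then have "norm w = \<bar>1 - R / 2 / d\<bar> * d"
    using proj(3)[of x] dR d R by (simp add: d_def)
  also have "\<dots> = R / 2 - d" using d dR R by (simp add: abs_if field_simps)
  finally have w: "norm w = R / 2 - d" .
  define \<rho> where "\<rho> = R / 2 - d"
  have \<rho>: "R / 4 \<le> \<rho>" "0 < \<rho>" using dR R by (auto simp: \<rho>_def)
  \<comment> \<open>These vectors are \<open>u - c\<close> and \<open>v - c\<close>, and no point of
    \<open>A\<close> is nearer to \<open>c\<close> than \<open>R / 2\<close>.\<close>
  have "R / 2 \<le> norm (w + (u - x))" "R / 2 \<le> norm (w + (v - x))"
    using c infdist_le[OF uv(1), of c] infdist_le[OF uv(2), of c]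
    by (auto simp: w_def dist_norm norm_minus_commute)
  then have "R / 2 \<le> (1 - l) * norm (w + (u - x)) + l * norm (w + (v - x))"
    using l convex_bound_le[of "- norm (w + (u - x))" "- R / 2" "- norm (w + (v - x))" "1 - l" l] by simp
  also have "\<dots> \<le> norm w + 2 * norm w * (C * (N / norm w) powr s)"
  proof (rule norm_convex_combination_le)
    show "w \<noteq> 0" using w \<rho> by (auto simp: \<rho>_def)
    show "(1 - l) *\<^sub>R (u - x) + l *\<^sub>R (v - x) = 0" unfolding ux vx by (simp add: algebra_simps)
    show "norm (u - x) \<le> N" "norm (v - x) \<le> N"
      unfolding nux nvx using l N by (auto intro: mult_left_le_one_le)
  qed (use l in auto)
  also have "\<dots> = \<rho> + 2 * \<rho> * (C * (N / \<rho>) powr s)" by (simp add: w \<rho>_def)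
  finally have "R / 2 \<le> \<rho> + 2 * \<rho> * (C * (N / \<rho>) powr s)" .
  moreover have "2 * \<rho> * (C * (N / \<rho>) powr s) = 2 * C * (\<rho> * (N / \<rho>) powr s)" by simp
  ultimately have "d \<le> 2 * C * (\<rho> * (N / \<rho>) powr s)" unfolding \<rho>_def by linarith
  moreover have "\<rho> * (N / \<rho>) powr s = N * (N / \<rho>) powr (s - 1)"
    using powr_mult_base[of "N / \<rho>" "s - 1"] \<rho> N by (simp add: field_simps)
  \<comment> \<open>The factor \<open>4 powr (s - 1)\<close> comes from
    \<open>\<rho> \<ge> R / 4\<close>.\<close>
  moreover have "(N / \<rho>) powr (s - 1) \<le> 4 powr (s - 1) * (N / R) powr (s - 1)"
  proof -
    have "N / \<rho> \<le> N / (R / 4)" using \<rho> N R by (intro divide_left_mono) auto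
    then have "N / \<rho> \<le> 4 * (N / R)" by (simp add: mult.commute)
    then have "(N / \<rho>) powr (s - 1) \<le> (4 * (N / R)) powr (s - 1)"
      using s N \<rho> by (intro powr_mono2) auto
    then show ?thesis by (simp only: powr_mult)
  qed
  ultimately have "d \<le> 2 * C * (N * (4 powr (s - 1) * (N / R) powr (s - 1)))"
    using N C by (smt (verit) mult_left_mono)
  then show ?thesis by (simp add: d_def N_def mult_ac)
qed

text \<open>Let \<open>q\<close> project \<open>x\<close> on the segment. The functional of
  \<open>u - v\<close> vanishes on \<open>q - midpoint u v\<close> and norms
  \<open>x - midpoint u v\<close>, so \<open>x\<close> is no farther from the midpoint than from
  \<open>q\<close>. Twice the depth bound results.\<close>

lemma slice_projection_near_midpoint:
  assumes q: "slice_projection A R u v q" and uv: "norm (u - v) \<le> R / 2"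
  shows "norm (q - midpoint u v)
    \<le> 4 * C * 4 powr (s - 1) * (norm (u - v) * (norm (u - v) / R) powr (s - 1))"
proof -
  define p where "p = blinfun_apply (supporting_functional (u - v))"
  have A: "u \<in> A" "v \<in> A" and ne: "u - v \<noteq> 0" using q by (auto simp: slice_projection_def)
  obtain x where x: "x \<in> closed_segment u v" "q \<in> metric_projection A x"
    using q unfolding slice_projection_def by blast
  have "q - midpoint u v \<in> supporting_hyperplane (u - v)"
    using q unfolding slice_projection_def by auto
  then have pq: "p (q - midpoint u v) = 0" by (simp add: supporting_hyperplane_def p_def)
  obtain l where l: "x = (1 - l) *\<^sub>R u + l *\<^sub>R v"
    using x unfolding in_segment by blast
  have xm: "x - midpoint u v = (1 / 2 - l) *\<^sub>R (u - v)"
  proof -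
    have "x - midpoint u v = (u - midpoint u v) - l *\<^sub>R (u - v)" by (simp add: l algebra_simps)
    then show ?thesis unfolding minus_midpoint by (simp add: algebra_simps)
  qed
  have qx: "norm (q - x) = infdist x A" using x(2) by (simp add: metric_projection_def)
  have "p (x - midpoint u v) = - p (q - x)"
    using pq by (simp add: p_def blinfun.diff_right)
  moreover have "\<bar>p (x - midpoint u v)\<bar> = norm (x - midpoint u v)"
    unfolding xm by (simp add: p_def blinfun.scaleR_right supporting_functional(2)[OF ne] abs_mult)
  moreover have "\<bar>p (q - x)\<bar> \<le> norm (q - x)"
    unfolding p_def by (rule supporting_functional_le[OF ne])
  ultimately have "norm (x - midpoint u v) \<le> norm (q - x)" by simp
  then have "norm (q - midpoint u v) \<le> 2 * infdist x A"
    using norm_triangle_ineq[of "q - x" "x - midpoint u v"] qx by simp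
  then show ?thesis using infdist_segment_le[OF A uv x(1)] by simp
qed

text \<open>The functional of \<open>u - v\<close> along the projected segment is continuous and has
  opposite signs at the ends, since \<open>proj\<close> fixes \<open>u\<close> and \<open>v\<close>.
  Segment points are at most \<open>norm (u - v) / 2 < R\<close> from \<open>A\<close>, so
  \<open>proj\<close> is continuous there.\<close>

lemma slice_projection_exists:
  assumes uv: "u \<in> A" "v \<in> A" "u \<noteq> v" "norm (u - v) < 2 * R"
  shows "\<exists>q. slice_projection A R u v q"
proof -
  define p where "p = blinfun_apply (supporting_functional (u - v))"
  have ne: "u - v \<noteq> 0" using uv by simp
  define L where "L t = (1 - t) *\<^sub>R u + t *\<^sub>R v" for t
  have seg: "closed_segment u v = L ` {0..1}" by (auto simp: L_def closed_segment_def)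
  have sub: "L ` {0..1} \<subseteq> {x. infdist x A < R}"
  proof (rule image_subsetI, rule CollectI)
    fix t :: real assume t: "t \<in> {0..1}"
    have "u - L t = t *\<^sub>R (u - v)" "L t - v = (1 - t) *\<^sub>R (u - v)" by (auto simp: L_def algebra_simps)
    then have "norm (u - L t) = t * norm (u - v)" "norm (L t - v) = (1 - t) * norm (u - v)"
      using t by auto
    then have "infdist (L t) A \<le> t * norm (u - v)" "infdist (L t) A \<le> (1 - t) * norm (u - v)"
      using infdist_le[OF uv(1), of "L t"] infdist_le[OF uv(2), of "L t"]
      by (auto simp: dist_norm norm_minus_commute)
    then have "2 * infdist (L t) A \<le> norm (u - v)" by (simp add: algebra_simps)
    then show "infdist (L t) A < R" using uv by simp
  qed
  have fix_A: "proj a = a" if "a \<in> A" for a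
  proof -
    have "0 < R" using uv(4) norm_ge_zero[of "u - v"] by linarith
    then show ?thesis using proj(4)[of a a] that by (simp add: metric_projection_def)
  qed
  define \<phi> where "\<phi> t = p (proj (L t) - midpoint u v)" for t
  have pe: "p (u - midpoint u v) = norm (u - v) / 2" "p (v - midpoint u v) = - (norm (u - v) / 2)"
  proof -
    show "p (u - midpoint u v) = norm (u - v) / 2" "p (v - midpoint u v) = - (norm (u - v) / 2)"
      unfolding minus_midpoint
      by (auto simp: p_def blinfun.scaleR_right blinfun.minus_right supporting_functional(2)[OF ne])
  qed
  have "\<exists>t. 0 \<le> t \<and> t \<le> 1 \<and> \<phi> t = 0"
  proof (rule IVT2')
    have "continuous_on {0..1} L" unfolding L_def by (intro continuous_intros)
    then have "continuous_on {0..1} (\<lambda>t. proj (L t))"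
      by (rule continuous_on_compose2[OF continuous_on_proj]) (rule sub)
    then show "continuous_on {0..1} \<phi>" unfolding \<phi>_def p_def by (intro continuous_intros)
    show "\<phi> 1 \<le> 0" "0 \<le> \<phi> 0" unfolding \<phi>_def by (simp_all add: L_def fix_A uv pe)
  qed simp
  then obtain t where t: "t \<in> {0..1}" "\<phi> t = 0" by auto
  have "proj (L t) \<in> (\<Union>x\<in>closed_segment u v. metric_projection A x)"
    unfolding seg using proj(1)[of "L t"] sub t by blast
  moreover have "proj (L t) \<in> (\<lambda>h. h + midpoint u v) ` supporting_hyperplane (u - v)"
    using t(2) unfolding \<phi>_def p_def supporting_hyperplane_def
    by (intro image_eqI[of _ _ "proj (L t) - midpoint u v"]) auto
  ultimately show ?thesis using uv by (auto simp: slice_projection_def)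
qed

text \<open>Relative to the midpoint, the functional vanishes at \<open>q\<close> but not at
  \<open>u\<close> or \<open>v\<close>. This keeps the chords of the next level
  non-degenerate.\<close>

lemma slice_projection_distinct:
  assumes "slice_projection A R u v q"
  shows "q \<in> A" "q \<noteq> u" "q \<noteq> v"
proof -
  define p where "p = blinfun_apply (supporting_functional (u - v))"
  have ne: "u - v \<noteq> 0" using assms by (auto simp: slice_projection_def)
  show "q \<in> A" using assms by (auto simp: slice_projection_def metric_projection_def)
  have "q - midpoint u v \<in> supporting_hyperplane (u - v)"
    using assms unfolding slice_projection_def by auto
  then have pq: "p (q - midpoint u v) = 0" by (simp add: supporting_hyperplane_def p_def)
  have "p (u - midpoint u v) \<noteq> 0" "p (v - midpoint u v) \<noteq> 0"
    unfolding minus_midpoint using ne by (auto simp: p_def blinfun.scaleR_right blinfun.minus_right supporting_functional(2)[OF ne])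
  then show "q \<noteq> u" "q \<noteq> v" using pq by auto
qed

end

section \<open>Dyadic refinement\<close>

text \<open>An interval of level \<open>Suc i\<close> is the left or the right half of one of level
  \<open>i\<close>, according to the parity of its index.\<close>

lemma dyadic_interval_cases:
  assumes "k \<in> {1..2 ^ Suc i :: nat}"
  obtains (left) j where "j \<in> {1..2 ^ i}" "real k = 2 * real j - 1"
    | (right) j where "j \<in> {1..2 ^ i}" "real k = 2 * real j"
proof (cases "even k")
  case True
  then obtain j where "k = 2 * j" by (rule evenE)
  then show thesis using assms by (intro right[of j]) auto
next
  case False
  then obtain j where "k = 2 * j + 1" by (rule oddE)
  then show thesis using assms by (intro left[of "j + 1"]) auto
qed

text \<open>Only the metric content of the first \<open>n\<close> steps is kept. The deviation bound
  is conditional on chords of length at most \<open>R / 2\<close>, which the decay of chords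
  supplies inductively; the constant \<open>1 / 4\<close> makes every chord shrink by the factor
  \<open>3 / 4\<close>.\<close>

locale dyadic_refinement =
  fixes f :: "real \<Rightarrow> 'a::real_normed_vector" and K R \<sigma> :: real and n :: nat
  assumes K: "0 \<le> K" and R: "0 < R" and \<sigma>: "0 < \<sigma>"
    and small: "norm (f 0 - f 1) \<le> R / 2" "K * (norm (f 0 - f 1) / R) powr \<sigma> \<le> 1 / 4"
    and step: "\<And>i j. i < n \<Longrightarrow> j \<in> {1..2 ^ i :: nat} \<Longrightarrow>
      norm (f ((real j - 1) / 2 ^ i) - f (real j / 2 ^ i)) \<le> R / 2 \<Longrightarrow>
      norm (f ((2 * real j - 1) / 2 ^ (i + 1)) - midpoint (f ((real j - 1) / 2 ^ i)) (f (real j / 2 ^ i)))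
        \<le> K * (norm (f ((real j - 1) / 2 ^ i) - f (real j / 2 ^ i)) *
            (norm (f ((real j - 1) / 2 ^ i) - f (real j / 2 ^ i)) / R) powr \<sigma>)"
begin

definition "chord i j = f (real j / 2 ^ i) - f ((real j - 1) / 2 ^ i)"

text \<open>Chords decaying like \<open>(3 / 4) ^ i\<close> have relative deviations decaying like
  \<open>q ^ i\<close>.\<close>

definition "q = (3 / 4 :: real) powr \<sigma>"

text \<open>Closed form of the sum of \<open>q ^ k\<close> over \<open>k < i\<close>.\<close>

definition "geo i = (1 - q ^ i) / (1 - q)"

definition "\<theta> = (norm (f 0 - f 1) / R) powr \<sigma>"

text \<open>Bounds every product of the growth factors \<open>1 + q ^ i / 2\<close>, through
  \<open>1 + x \<le> exp x\<close>.\<close>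

definition "B = exp (1 / (2 * (1 - q)))"

lemma q: "0 < q" "q < 1"
  using \<sigma> powr_less_mono2[of \<sigma> "3 / 4" 1] by (auto simp: q_def)

lemma geo: "geo 0 = 0" "geo (Suc i) = geo i + q ^ i" "0 \<le> geo i" "geo i \<le> 1 / (1 - q)"
proof -
  show "geo 0 = 0" by (simp add: geo_def)
  show "geo (Suc i) = geo i + q ^ i" using q by (simp add: geo_def field_simps)
  show "0 \<le> geo i" using q by (simp add: geo_def power_le_one)
  show "geo i \<le> 1 / (1 - q)" using q unfolding geo_def by (intro divide_right_mono) auto
qed

lemma \<theta>: "0 \<le> \<theta>"
  by (simp add: \<theta>_def)

lemma decayed_deviation_le:
  assumes "0 \<le> N" "N \<le> norm (f 0 - f 1) * (3 / 4) ^ i"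
  shows "N \<le> R / 2" "(N / R) powr \<sigma> \<le> \<theta> * q ^ i"
proof -
  have "norm (f 0 - f 1) * (3 / 4) ^ i \<le> norm (f 0 - f 1) * 1"
    by (intro mult_left_mono) (auto intro: power_le_one)
  then show "N \<le> R / 2" using assms small by simp
  have "(N / R) powr \<sigma> \<le> ((norm (f 0 - f 1) / R) * (3 / 4) ^ i) powr \<sigma>"
    using assms R \<sigma> by (intro powr_mono2) (auto simp: field_simps)
  also have "\<dots> = \<theta> * ((3 / 4) ^ i) powr \<sigma>" unfolding \<theta>_def by (rule powr_mult)
  also have "((3 / 4 :: real) ^ i) powr \<sigma> = q ^ i"
    by (simp add: q_def powr_powr mult.commute flip: powr_realpow)
  finally show "(N / R) powr \<sigma> \<le> \<theta> * q ^ i" .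
qed

text \<open>A new chord is half of the old one plus the deviation of the new node, and
  \<open>K * \<theta> \<le> 1 / 4\<close>.\<close>

lemma refined_chord:
  assumes i: "i < n" and j: "j \<in> {1..2 ^ i}" and N: "norm (chord i j) \<le> norm (f 0 - f 1) * (3 / 4) ^ i"
  shows "norm (f ((2 * real j - 1) / 2 ^ (i + 1)) - midpoint (f ((real j - 1) / 2 ^ i)) (f (real j / 2 ^ i)))
      \<le> norm (chord i j) * (K * \<theta>) * q ^ i"
    and "norm (f ((2 * real j - 1) / 2 ^ (i + 1)) - f ((real j - 1) / 2 ^ i)) \<le> norm (chord i j) * (1 / 2 + q ^ i / 4)"
    and "norm (f (real j / 2 ^ i) - f ((2 * real j - 1) / 2 ^ (i + 1))) \<le> norm (chord i j) * (1 / 2 + q ^ i / 4)"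
proof -
  let ?m = "f ((2 * real j - 1) / 2 ^ (i + 1))" and ?E = "norm (chord i j) * (K * \<theta>) * q ^ i"
  define u v where "u = f ((real j - 1) / 2 ^ i)" and "v = f (real j / 2 ^ i)"
  have c: "norm (u - v) = norm (chord i j)" by (simp add: chord_def u_def v_def norm_minus_commute)
  note d = decayed_deviation_le[OF norm_ge_zero N]
  have "norm (?m - midpoint u v) \<le> K * (norm (u - v) * (norm (u - v) / R) powr \<sigma>)"
    unfolding u_def v_def by (rule step[OF i j]) (use d(1) c in \<open>simp add: u_def v_def\<close>)
  also have "\<dots> \<le> K * (norm (u - v) * (\<theta> * q ^ i))"
    unfolding c using d K by (intro mult_left_mono) auto
  finally have m: "norm (?m - midpoint u v) \<le> ?E" by (simp add: c mult_ac)
  then show "norm (?m - midpoint (f ((real j - 1) / 2 ^ i)) (f (real j / 2 ^ i))) \<le> ?E"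
    by (simp add: u_def v_def)
  have "?E \<le> norm (chord i j) * (1 / 4) * q ^ i"
    using small(2) q by (intro mult_right_mono mult_left_mono) (auto simp: \<theta>_def)
  then have m': "norm (?m - midpoint u v) \<le> norm (chord i j) * (q ^ i / 4)" using m by simp
  have "norm (u - midpoint u v) = norm (chord i j) / 2" "norm (v - midpoint u v) = norm (chord i j) / 2"
    unfolding minus_midpoint using c by auto
  then show "norm (?m - f ((real j - 1) / 2 ^ i)) \<le> norm (chord i j) * (1 / 2 + q ^ i / 4)"
    "norm (f (real j / 2 ^ i) - ?m) \<le> norm (chord i j) * (1 / 2 + q ^ i / 4)"
    using m' norm_triangle_ineq4[of "?m - midpoint u v" "u - midpoint u v"]
      norm_triangle_ineq4[of "v - midpoint u v" "?m - midpoint u v"]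
    by (auto simp: u_def v_def algebra_simps)
qed

text \<open>The lengths at least decay like \<open>(3/4)^i\<close>, so that the relative deviations are summable;
  hence their product is bounded and the lengths in fact decay like \<open>1/2^i\<close>.\<close>
lemma norm_chord_le:
  assumes "i \<le> n" "j \<in> {1..2 ^ i}"
  shows "norm (chord i j) \<le> norm (f 0 - f 1) * (3 / 4) ^ i
    \<and> norm (chord i j) \<le> norm (f 0 - f 1) * exp (geo i / 2) / 2 ^ i"
  using assms
proof (induction i arbitrary: j)
  case 0
  then have "j = 1" by auto
  then show ?case by (simp add: chord_def geo norm_minus_commute)
next
  case (Suc i)
  have "\<exists>j'\<in>{1..2 ^ i}. norm (chord (Suc i) j) \<le> norm (chord i j') * (1 / 2 + q ^ i / 4)"
    using Suc.prems(2)
  proof (cases rule: dyadic_interval_cases)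
    case (left j')
    have "chord (Suc i) j = f ((2 * real j' - 1) / 2 ^ (i + 1)) - f ((real j' - 1) / 2 ^ i)"
    proof -
      have "(real j - 1) / 2 ^ Suc i = (real j' - 1) / 2 ^ i"
        unfolding left(2) by (simp add: field_simps)
      then show ?thesis unfolding chord_def using left(2) by simp
    qed
    then show ?thesis using left(1) refined_chord(2)[of i j'] Suc by auto
  next
    case (right j')
    have "chord (Suc i) j = f (real j' / 2 ^ i) - f ((2 * real j' - 1) / 2 ^ (i + 1))"
      unfolding chord_def using right(2) by simp
    then show ?thesis using right(1) refined_chord(3)[of i j'] Suc by auto
  qed
  then obtain j' where j': "j' \<in> {1..2 ^ i}"
    "norm (chord (Suc i) j) \<le> norm (chord i j') * (1 / 2 + q ^ i / 4)" by blast
  have IH: "norm (chord i j') \<le> norm (f 0 - f 1) * (3 / 4) ^ i"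
    "norm (chord i j') \<le> norm (f 0 - f 1) * exp (geo i / 2) / 2 ^ i"
    using Suc.IH[OF _ j'(1)] Suc.prems by auto
  have q1: "0 \<le> q ^ i" "q ^ i \<le> 1" using q by (auto intro: power_le_one)
  have "norm (chord i j') * (1 / 2 + q ^ i / 4) \<le> (norm (f 0 - f 1) * (3 / 4) ^ i) * (3 / 4)"
    using IH q1 by (intro mult_mono) auto
  \<comment> \<open>The same factor is half of \<open>1 + q ^ i / 2\<close>, hence at most
    \<open>exp (q ^ i / 2) / 2\<close>; the exponents accumulate to \<open>geo\<close>.\<close>
  moreover have "norm (chord i j') * (1 / 2 + q ^ i / 4)
      \<le> (norm (f 0 - f 1) * exp (geo i / 2) / 2 ^ i) * (exp (q ^ i / 2) / 2)"
    using IH q1 exp_ge_add_one_self[of "q ^ i / 2"] by (intro mult_mono) auto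
  moreover have "exp (geo (Suc i) / 2) = exp (geo i / 2) * exp (q ^ i / 2)"
    by (simp add: geo add_divide_distrib exp_add)
  ultimately show ?case using j'(2) by auto
qed

lemma exp_geo_le: "exp (geo i / 2) \<le> B"
  using divide_right_mono[OF geo(4)[of i], of 2] q by (simp add: B_def divide_divide_eq_left mult.commute)

lemma norm_chord_le':
  assumes "i \<le> n" "j \<in> {1..2 ^ i}"
  shows "norm (chord i j) \<le> B * norm (f 0 - f 1) / 2 ^ i"
proof -
  have "norm (f 0 - f 1) * exp (geo i / 2) / 2 ^ i \<le> norm (f 0 - f 1) * B / 2 ^ i"
    by (intro divide_right_mono mult_left_mono exp_geo_le) auto
  then show ?thesis using norm_chord_le[OF assms] by (simp add: mult.commute)
qed

lemma dyadic_Lipschitz: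
  assumes "i \<le> n" "j \<le> k" "k \<le> 2 ^ i"
  shows "norm (f (real k / 2 ^ i) - f (real j / 2 ^ i))
    \<le> B * norm (f 0 - f 1) * (real k / 2 ^ i - real j / 2 ^ i)"
  using assms(2,3)
proof (induction k rule: dec_induct)
  case (step k)
  have "norm (chord i (Suc k)) \<le> B * norm (f 0 - f 1) / 2 ^ i"
    using step assms by (intro norm_chord_le') auto
  then have "norm (f (real (Suc k) / 2 ^ i) - f (real j / 2 ^ i))
      \<le> B * norm (f 0 - f 1) / 2 ^ i + B * norm (f 0 - f 1) * (real k / 2 ^ i - real j / 2 ^ i)"
    using norm_triangle_ineq[of "chord i (Suc k)" "f (real k / 2 ^ i) - f (real j / 2 ^ i)"] step
    by (simp add: chord_def)
  also have "\<dots> = B * norm (f 0 - f 1) * (real (Suc k) / 2 ^ i - real j / 2 ^ i)"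
    by (simp add: field_simps)
  finally show ?case .
qed simp

definition "defect t = f t - ((1 - t) *\<^sub>R f 0 + t *\<^sub>R f 1)"

text \<open>Dividing by \<open>min t (1 - t) \<ge> 1 / 2 ^ (i + 1)\<close>, the deviations at a new midpoint
  of level \<open>i + 1\<close> form a geometric series.\<close>
lemma norm_defect_le:
  assumes "i \<le> n" "k \<le> 2 ^ i"
  shows "norm (defect (real k / 2 ^ i))
    \<le> 2 * K * B * norm (f 0 - f 1) * \<theta> * geo i * min (real k / 2 ^ i) (1 - real k / 2 ^ i)"
  using assms
proof (induction i arbitrary: k)
  case 0
  then have "k = 0 \<or> k = 1" by auto
  then show ?case by (auto simp: defect_def)
next
  case (Suc i)
  define M where "M = 2 * K * B * norm (f 0 - f 1) * \<theta>"
  define mn where "mn t = min t (1 - t)" for t :: real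
  have M: "0 \<le> M" using K \<theta> by (simp add: M_def B_def)
  have IH: "norm (defect (real k / 2 ^ i)) \<le> M * geo i * mn (real k / 2 ^ i)" if "k \<le> 2 ^ i" for k
    using Suc.IH[OF _ that] Suc.prems(1) by (simp add: M_def mn_def)
  have q0: "0 \<le> q ^ i" using q by simp
  have mn0: "0 \<le> mn (real k / 2 ^ Suc i)"
  proof -
    have "real k \<le> 2 ^ Suc i" using Suc.prems(2) by (metis of_nat_le_iff of_nat_power of_nat_numeral)
    then show ?thesis by (simp add: mn_def)
  qed
  show ?case
  proof (cases "k = 0")
    case True
    then show ?thesis by (simp add: defect_def)
  next
    case False
    then have "k \<in> {1..2 ^ Suc i}" using Suc.prems by auto
    then show ?thesis
    proof (cases rule: dyadic_interval_cases)
      \<comment> \<open>An even node already belongs to level \<open>i\<close>; only the bound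
        grows.\<close>
      case (right j)
      then have eq: "real k / 2 ^ Suc i = real j / 2 ^ i" by simp
      have "norm (defect (real j / 2 ^ i)) \<le> M * geo i * mn (real j / 2 ^ i)"
        using right by (intro IH) auto
      also have "\<dots> \<le> M * geo (Suc i) * mn (real j / 2 ^ i)"
        using M q0 mn0 eq by (intro mult_right_mono mult_left_mono) (auto simp: geo)
      finally show ?thesis unfolding eq by (simp add: M_def mn_def)
    next
      case (left j)
      define a b m where "a = (real j - 1) / 2 ^ i" and "b = real j / 2 ^ i" and "m = real k / 2 ^ Suc i"
      have m: "m = (a + b) / 2" "m = (2 * real j - 1) / 2 ^ (i + 1)"
        using left(2) by (auto simp: a_def b_def m_def field_simps)
      have "a = real (j - 1) / 2 ^ i" using left by (simp add: a_def of_nat_diff)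
      then have IHa: "norm (defect a) \<le> M * geo i * mn a"
        using IH[of "j - 1"] left by auto
      have IHb: "norm (defect b) \<le> M * geo i * mn b"
        unfolding b_def using left by (intro IH) auto
      \<comment> \<open>The affine part takes midpoints to midpoints and cancels.\<close>
      have "norm (defect m - midpoint (defect a) (defect b)) = norm (f m - midpoint (f a) (f b))"
      proof -
        define L where "L t = (1 - t) *\<^sub>R f 0 + t *\<^sub>R f 1" for t
        have d: "defect t = f t - L t" for t by (simp add: defect_def L_def)
        have "L a + L b = (2 - (a + b)) *\<^sub>R f 0 + (a + b) *\<^sub>R f 1" 
          by (simp add: L_def algebra_simps scaleR_2)
        also have "\<dots> = 2 *\<^sub>R L m"
        proof -
          have m2: "2 * (1 - m) = 2 - (a + b)" "2 * m = a + b" using m(1) by auto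
          show ?thesis unfolding L_def scaleR_right_distrib scaleR_scaleR m2 ..
        qed
        finally have "midpoint (L a) (L b) = L m" by (simp add: midpoint_def)
        moreover have "midpoint (defect a) (defect b) = midpoint (f a) (f b) - midpoint (L a) (L b)"
          by (simp add: d midpoint_def algebra_simps)
        ultimately show ?thesis by (simp add: d)
      qed
      also have "\<dots> \<le> norm (chord i j) * (K * \<theta>) * q ^ i"
        unfolding m(2) a_def b_def using left Suc.prems norm_chord_le[of i j]
        by (intro refined_chord) auto
      also have "\<dots> \<le> (B * norm (f 0 - f 1) / 2 ^ i) * (K * \<theta>) * q ^ i"
        using left Suc.prems K \<theta> q0 by (intro mult_right_mono norm_chord_le') auto
      also have "\<dots> = M * q ^ i * (1 / 2 ^ Suc i)" by (simp add: M_def)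
      also have "\<dots> \<le> M * q ^ i * mn m"
      proof (rule mult_left_mono)
        have "real j \<le> 2 ^ i" "1 \<le> real j" using left(1) by (auto simp flip: of_nat_le_iff)
        then show "1 / 2 ^ Suc i \<le> mn m" unfolding mn_def m_def left(2) by (simp add: field_simps)
      qed (use M q0 in simp)
      finally have dev: "norm (defect m - midpoint (defect a) (defect b)) \<le> M * q ^ i * mn m" .
      have "norm (midpoint (defect a) (defect b)) \<le> (norm (defect a) + norm (defect b)) / 2"
        using norm_triangle_ineq[of "defect a" "defect b"] by (simp add: midpoint_def)
      also have "\<dots> \<le> M * geo i * ((mn a + mn b) / 2)"
        using IHa IHb by (simp add: algebra_simps)
      \<comment> \<open>Concavity of \<open>min t (1 - t)\<close>.\<close>
      also have "\<dots> \<le> M * geo i * mn m"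
      proof (rule mult_left_mono)
        have "2 * m = a + b" using m(1) by simp
        moreover have "mn a \<le> a" "mn a \<le> 1 - a" "mn b \<le> b" "mn b \<le> 1 - b" by (auto simp: mn_def)
        ultimately have "(mn a + mn b) / 2 \<le> m" "(mn a + mn b) / 2 \<le> 1 - m" by argo+
        then show "(mn a + mn b) / 2 \<le> mn m" by (simp add: mn_def)
      qed (use M geo(3)[of i] in simp)
      finally have "norm (defect m) \<le> M * geo i * mn m + M * q ^ i * mn m"
        using dev norm_triangle_ineq[of "midpoint (defect a) (defect b)"
            "defect m - midpoint (defect a) (defect b)"] by simp
      also have "\<dots> = M * geo (Suc i) * mn m" by (simp add: geo algebra_simps)
      finally show ?thesis by (simp add: M_def mn_def m_def)
    qed
  qed
qed

text \<open>The partial sum is replaced by the full geometric series to remove the level; the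
  bracket becomes the radius of the ball.\<close>

lemma norm_defect_le':
  assumes "i \<le> n" "k \<le> 2 ^ i"
  shows "norm (defect (real k / 2 ^ i))
    \<le> 2 * (K * B / (1 - q) * norm (f 0 - f 1) * \<theta>) * min (real k / 2 ^ i) (1 - real k / 2 ^ i)"
proof -
  have "real k \<le> 2 ^ i" using assms(2) by (metis of_nat_le_iff of_nat_power of_nat_numeral)
  then have "0 \<le> min (real k / 2 ^ i) (1 - real k / 2 ^ i)" by simp
  then have "2 * K * B * norm (f 0 - f 1) * \<theta> * geo i * min (real k / 2 ^ i) (1 - real k / 2 ^ i)
      \<le> 2 * K * B * norm (f 0 - f 1) * \<theta> * (1 / (1 - q)) * min (real k / 2 ^ i) (1 - real k / 2 ^ i)"
    using K \<theta> geo(4) by (intro mult_right_mono mult_left_mono) (auto simp: B_def)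
  then show ?thesis using norm_defect_le[OF assms] by (simp add: mult_ac)
qed

end

lemma dyadic_levelI: "j \<le> 2 ^ i \<Longrightarrow> real j / 2 ^ i \<in> dyadic_level i"
  unfolding dyadic_level_def by blast

lemma dyadic_levelE:
  assumes "t \<in> dyadic_level i"
  obtains j where "t = real j / 2 ^ i" "j \<le> 2 ^ i"
  using assms unfolding dyadic_level_def by blast

lemma dyadic_level_mono: "i \<le> k \<Longrightarrow> dyadic_level i \<subseteq> dyadic_level k"
proof
  fix t assume ik: "i \<le> k" and "t \<in> dyadic_level i"
  then obtain j where j: "t = real j / 2 ^ i" "j \<le> 2 ^ i" by (blast elim: dyadic_levelE)
  have "(2::real) ^ k = 2 ^ i * 2 ^ (k - i)" "(2::nat) ^ k = 2 ^ i * 2 ^ (k - i)"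
    using ik by (auto simp flip: power_add)
  then have "t = real (j * 2 ^ (k - i)) / 2 ^ k" "j * 2 ^ (k - i) \<le> 2 ^ k" using j by auto
  then show "t \<in> dyadic_level k" using dyadic_levelI by metis
qed

lemma dyadic_level_subset: "dyadic_level i \<subseteq> {0..1}"
proof
  fix t assume "t \<in> dyadic_level i"
  then obtain j where "t = real j / 2 ^ i" "j \<le> 2 ^ i" by (blast elim: dyadic_levelE)
  moreover from this have "real j \<le> 2 ^ i" by (metis of_nat_le_iff of_nat_power of_nat_numeral)
  ultimately show "t \<in> {0..1}" by simp
qed

lemma closure_dyadic_levels: "closure (\<Union>i. dyadic_level i) = {0..1}"
proof
  show "closure (\<Union>i. dyadic_level i) \<subseteq> {0..1}"
    using dyadic_level_subset by (intro closure_minimal) auto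
  show "{0..1} \<subseteq> closure (\<Union>i. dyadic_level i)"
  proof
    fix t :: real assume t: "t \<in> {0..1}"
    show "t \<in> closure (\<Union>i. dyadic_level i)"
      unfolding closure_approachable
    proof (intro allI impI)
      fix e :: real assume "0 < e"
      then obtain i where i: "(1 / 2) ^ i < e" using real_arch_pow_inv[of e "1 / 2"] by auto
      define j where "j = nat \<lfloor>t * 2 ^ i\<rfloor>"
      have j: "real j = of_int \<lfloor>t * 2 ^ i\<rfloor>" using t by (simp add: j_def)
      have "real j \<le> t * 2 ^ i" "t * 2 ^ i < real j + 1" unfolding j by linarith+
      moreover have "t * 2 ^ i \<le> 2 ^ i" using t by simp
      ultimately have "real j \<le> 2 ^ i" and "real j / 2 ^ i \<le> t" "t < (real j + 1) / 2 ^ i"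
        by (linarith, simp_all add: pos_divide_le_eq pos_less_divide_eq)
      then have d: "\<bar>real j / 2 ^ i - t\<bar> < (1 / 2) ^ i"
        by (simp add: add_divide_distrib power_divide)
      have "j \<le> 2 ^ i" using \<open>real j \<le> 2 ^ i\<close> by (metis of_nat_le_iff of_nat_power of_nat_numeral)
      then have "real j / 2 ^ i \<in> (\<Union>i. dyadic_level i)" using dyadic_levelI by blast
      then show "\<exists>y\<in>\<Union>i. dyadic_level i. dist y t < e"
        using d i by (intro bexI[of _ "real j / 2 ^ i"]) (auto simp: dist_real_def)
    qed
  qed
qed

text \<open>For \<open>t \<le> 1 / 2\<close> write \<open>y\<close> as
  \<open>(1 - 2 * t) *\<^sub>R x0 + (2 * t) *\<^sub>R z\<close>; the tapered bound is exactly what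
  puts \<open>z\<close> into the ball. The other half follows by swapping the endpoints.\<close>

lemma in_hull_of_tapered_tube:
  fixes x0 x1 y :: "'a::real_normed_vector"
  assumes t: "t \<in> {0..1}" and r: "0 \<le> r"
    and y: "norm (y - ((1 - t) *\<^sub>R x0 + t *\<^sub>R x1)) \<le> 2 * r * min t (1 - t)"
  shows "y \<in> convex hull ({x0} \<union> cball (midpoint x0 x1) r \<union> {x1})" (is "_ \<in> ?H")
proof -
  have half: "y \<in> convex hull ({a} \<union> cball (midpoint a b) r)"
    if t: "0 \<le> t" "t \<le> 1 / 2" and y: "norm (y - ((1 - t) *\<^sub>R a + t *\<^sub>R b)) \<le> 2 * r * t"
    for a b :: 'a and t
  proof (cases "t = 0")
    case True
    then show ?thesis using y by (auto intro: hull_inc)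
  next
    case False
    define z where "z = midpoint a b + (1 / (2 * t)) *\<^sub>R (y - ((1 - t) *\<^sub>R a + t *\<^sub>R b))"
    have "norm ((1 / (2 * t)) *\<^sub>R (y - ((1 - t) *\<^sub>R a + t *\<^sub>R b))) \<le> r"
      using y t False by (simp add: pos_divide_le_eq mult_ac)
    then have "z \<in> cball (midpoint a b) r" by (simp add: z_def dist_norm)
    then have "(1 - 2 * t) *\<^sub>R a + (2 * t) *\<^sub>R z \<in> convex hull ({a} \<union> cball (midpoint a b) r)"
      using t by (intro convexD[OF convex_convex_hull] hull_inc) auto
    moreover have "(1 - 2 * t) *\<^sub>R a + (2 * t) *\<^sub>R z = y"
    proof -
      have "(2 * t) *\<^sub>R midpoint a b = t *\<^sub>R a + t *\<^sub>R b"
        by (simp add: midpoint_def scaleR_right_distrib)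
      then have "(2 * t) *\<^sub>R z = (t *\<^sub>R a + t *\<^sub>R b) + (y - ((1 - t) *\<^sub>R a + t *\<^sub>R b))"
        using False unfolding z_def scaleR_right_distrib[of "2 * t"] by simp
      moreover have "(1 - 2 * t) *\<^sub>R a = (1 - t) *\<^sub>R a - t *\<^sub>R a"
        by (simp flip: scaleR_left_diff_distrib)
      ultimately show ?thesis by simp
    qed
    ultimately show ?thesis by simp
  qed
  show ?thesis
  proof (cases "t \<le> 1 / 2")
    case True
    then have "y \<in> convex hull ({x0} \<union> cball (midpoint x0 x1) r)"
      using t y by (intro half[of t]) auto
    then show ?thesis using hull_mono[of "{x0} \<union> cball (midpoint x0 x1) r"] by blast
  next
    case False
    then have "y \<in> convex hull ({x1} \<union> cball (midpoint x1 x0) r)"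
      using t y by (intro half[of "1 - t"]) (auto simp: add.commute)
    then show ?thesis
      using hull_mono[of "{x1} \<union> cball (midpoint x0 x1) r" "{x0} \<union> cball (midpoint x0 x1) r \<union> {x1}"]
      by (auto simp: midpoint_sym[of x1 x0])
  qed
qed

section \<open>The curve construction as a dyadic refinement\<close>

lemma curve_construction_upto_step:
  assumes "curve_construction_upto A R x0 x1 n f" "i < n" "j \<in> {1..2 ^ i}"
  shows "slice_projection A R (f ((real j - 1) / 2 ^ i)) (f (real j / 2 ^ i))
    (f ((2 * real j - 1) / 2 ^ (i + 1)))"
  using assms by (auto simp: curve_construction_upto_def)

text \<open>Supplies what the next slice-projections require of their endpoints, apart from the
  bound on their distance.\<close>

lemma (in smooth_tube) curve_construction_nodes:
  assumes f: "curve_construction_upto A R x0 x1 n f" and x: "x0 \<in> A" "x1 \<in> A" "x0 \<noteq> x1"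
    and "i \<le> n" "j \<in> {1..2 ^ i}"
  shows "f ((real j - 1) / 2 ^ i) \<in> A \<and> f (real j / 2 ^ i) \<in> A
    \<and> f ((real j - 1) / 2 ^ i) \<noteq> f (real j / 2 ^ i)"
  using assms(5,6)
proof (induction i arbitrary: j)
  case 0
  then have "j = 1" by auto
  then show ?case using f x by (auto simp: curve_construction_upto_def)
next
  case (Suc i)
  from Suc.prems(2) show ?case
  proof (cases rule: dyadic_interval_cases)
    case (left j')
    have eq: "(real j - 1) / 2 ^ Suc i = (real j' - 1) / 2 ^ i"
      "real j / 2 ^ Suc i = (2 * real j' - 1) / 2 ^ (i + 1)"
      unfolding left(2) by (auto simp: field_simps)
    show ?thesis
      unfolding eq
      using slice_projection_distinct[OF curve_construction_upto_step[OF f _ left(1)]]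
        Suc.IH[OF _ left(1)] Suc.prems by auto
  next
    case (right j')
    have eq: "(real j - 1) / 2 ^ Suc i = (2 * real j' - 1) / 2 ^ (i + 1)"
      "real j / 2 ^ Suc i = real j' / 2 ^ i"
      unfolding right(2) by (auto simp: field_simps)
    show ?thesis
      unfolding eq
      using slice_projection_distinct[OF curve_construction_upto_step[OF f _ right(1)]]
        Suc.IH[OF _ right(1)] Suc.prems by auto
  qed
qed

lemma (in smooth_tube) curve_construction_refinement:
  assumes "curve_construction_upto A R x0 x1 n f" and R: "0 < R"
    and "norm (x0 - x1) \<le> R / 2" "4 * C * 4 powr (s - 1) * (norm (x0 - x1) / R) powr (s - 1) \<le> 1 / 4"
  shows "dyadic_refinement f (4 * C * 4 powr (s - 1)) R (s - 1) n"
proof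
  have "f 0 = x0" "f 1 = x1" using assms by (auto simp: curve_construction_upto_def)
  then show "norm (f 0 - f 1) \<le> R / 2"
    "4 * C * 4 powr (s - 1) * (norm (f 0 - f 1) / R) powr (s - 1) \<le> 1 / 4"
    using assms by auto
  show "norm (f ((2 * real j - 1) / 2 ^ (i + 1)) - midpoint (f ((real j - 1) / 2 ^ i)) (f (real j / 2 ^ i)))
      \<le> 4 * C * 4 powr (s - 1) * (norm (f ((real j - 1) / 2 ^ i) - f (real j / 2 ^ i)) *
            (norm (f ((real j - 1) / 2 ^ i) - f (real j / 2 ^ i)) / R) powr (s - 1))"
    if "i < n" "j \<in> {1..2 ^ i :: nat}"
      "norm (f ((real j - 1) / 2 ^ i) - f (real j / 2 ^ i)) \<le> R / 2" for i j
    by (rule slice_projection_near_midpoint[OF curve_construction_upto_step[OF assms(1)]]) (rule that)+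
qed (use C s R in auto)

theorem theorem2:
  fixes s :: real
  assumes "uniformly_convex_space TYPE('a::banach)"
    and "uniformly_smooth_space TYPE('a)"
    and "1 < s" and "s \<le> 2"
    and "smoothness_of_power_type TYPE('a) s"
  shows "\<exists>\<beta>\<^sub>I>0. \<exists>L\<^sub>I>0. \<forall>R>0. \<forall>A :: 'a set. \<forall>x0\<in>A. \<forall>x1\<in>A.
    proximally_smooth R A \<longrightarrow> x0 \<noteq> x1 \<longrightarrow> norm (x0 - x1) / R < \<beta>\<^sub>I \<longrightarrow>
      (\<forall>n f. curve_construction_upto A R x0 x1 n f \<longrightarrow>
        (\<forall>j\<in>{1..2 ^ n :: nat}. \<exists>q.
          slice_projection A R (f ((real j - 1) / 2 ^ n)) (f (real j / 2 ^ n)) q)) \<and>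
      (\<forall>f. (\<forall>n. curve_construction_upto A R x0 x1 n f) \<longrightarrow>
        (\<exists>g :: real \<Rightarrow> 'a.
          continuous_on {0..1} g \<and>
          g ` {0..1} \<subseteq> A \<and>
          (\<forall>i. \<forall>t\<in>dyadic_level i. g t = f t) \<and>
          g 0 = x0 \<and> g 1 = x1 \<and>
          g ` {0..1} \<subseteq> convex hull
            ({x0} \<union>
             cball (midpoint x0 x1) (L\<^sub>I * norm (x0 - x1) * (norm (x0 - x1) / R) powr (s - 1)) \<union>
             {x1})))"
proof -
  obtain C where "power_smooth TYPE('a) C s"
    using smoothness_of_power_type_power_smooth[OF assms(5,3)] by blast
  then interpret power_smooth "TYPE('a)" C s .
  define K where "K = 4 * C * 4 powr (s - 1)"
  define q where "q = (3 / 4 :: real) powr (s - 1)"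
  \<comment> \<open>The first bound gives chords of length at most \<open>R / 2\<close>, the second
    an initial relative deviation of at most \<open>1 / 4\<close>.\<close>
  define \<beta> where "\<beta> = min (1 / 2) ((1 / (4 * K)) powr (1 / (s - 1)))"
  define L where "L = K * exp (1 / (2 * (1 - q))) / (1 - q)"
  have K: "0 < K" using C by (simp add: K_def)
  have q1: "q < 1" using s powr_less_mono2[of "s - 1" "3 / 4" 1] by (simp add: q_def)
  have \<beta>: "0 < \<beta>" and L: "0 < L" using K q1 by (auto simp: \<beta>_def L_def)
  have main: "(\<forall>n f. curve_construction_upto A R x0 x1 n f \<longrightarrow>
        (\<forall>j\<in>{1..2 ^ n :: nat}. \<exists>q.
          slice_projection A R (f ((real j - 1) / 2 ^ n)) (f (real j / 2 ^ n)) q)) \<and>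
      (\<forall>f. (\<forall>n. curve_construction_upto A R x0 x1 n f) \<longrightarrow>
        (\<exists>g :: real \<Rightarrow> 'a.
          continuous_on {0..1} g \<and>
          g ` {0..1} \<subseteq> A \<and>
          (\<forall>i. \<forall>t\<in>dyadic_level i. g t = f t) \<and>
          g 0 = x0 \<and> g 1 = x1 \<and>
          g ` {0..1} \<subseteq> convex hull
            ({x0} \<union>
             cball (midpoint x0 x1) (L * norm (x0 - x1) * (norm (x0 - x1) / R) powr (s - 1)) \<union>
             {x1})))"
    if R: "0 < R" and x: "x0 \<in> A" "x1 \<in> A" "x0 \<noteq> x1" and A: "proximally_smooth R A"
      and small: "norm (x0 - x1) / R < \<beta>" for R :: real and A :: "'a set" and x0 x1
  proof -
    have "differentiable_tube A R"
      using proximally_smooth_differentiable_tube[OF assms(1) A] x by blast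
    then interpret differentiable_tube A R .
    interpret smooth_tube A R C s by unfold_locales
    have "norm (x0 - x1) / R < 1 / 2" using small by (simp add: \<beta>_def)
    then have R2: "norm (x0 - x1) \<le> R / 2" using R by (simp add: pos_divide_less_eq)
    have "(norm (x0 - x1) / R) powr (s - 1) \<le> ((1 / (4 * K)) powr (1 / (s - 1))) powr (s - 1)"
      using small R s by (intro powr_mono2) (auto simp: \<beta>_def)
    also have "\<dots> = 1 / (4 * K)" using s K by (simp add: powr_powr)
    finally have K4: "K * (norm (x0 - x1) / R) powr (s - 1) \<le> 1 / 4"
      using K by (simp add: field_simps)
    have refinement: "dyadic_refinement f K R (s - 1) n" if "curve_construction_upto A R x0 x1 n f" for n f
      using curve_construction_refinement[OF that R R2] K4 unfolding K_def by blast
    show ?thesis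
    proof (intro conjI allI impI ballI)
      fix n f j
      assume f: "curve_construction_upto A R x0 x1 n f" and j: "j \<in> {1..2 ^ n :: nat}"
      interpret dyadic_refinement f K R "s - 1" n by (rule refinement[OF f])
      have f01: "f 0 = x0" "f 1 = x1" using f by (auto simp: curve_construction_upto_def)
      \<comment> \<open>No chord is longer than the initial one, so the condition
        \<open>< 2 * R\<close> holds at every level.\<close>
      have "norm (f 0 - f 1) * (3 / 4) ^ n \<le> norm (f 0 - f 1) * 1"
        by (intro mult_left_mono) (auto intro: power_le_one)
      then have "norm (chord n j) \<le> R / 2"
        using norm_chord_le[OF order_refl j] R2 by (simp add: f01)
      then have "norm (f ((real j - 1) / 2 ^ n) - f (real j / 2 ^ n)) < 2 * R"
        using R by (simp add: chord_def norm_minus_commute)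
      then show "\<exists>q. slice_projection A R (f ((real j - 1) / 2 ^ n)) (f (real j / 2 ^ n)) q"
        using curve_construction_nodes[OF f x order_refl j] by (intro slice_projection_exists) auto
    next
      fix f assume f: "\<forall>n. curve_construction_upto A R x0 x1 n f"
      have f01: "f 0 = x0" "f 1 = x1" using f by (auto simp: curve_construction_upto_def)
      define D where "D = (\<Union>i. dyadic_level i)"
      define M where "M = exp (1 / (2 * (1 - q))) * norm (x0 - x1)"
      define r where "r = L * norm (x0 - x1) * (norm (x0 - x1) / R) powr (s - 1)"
      have M: "0 \<le> M" and r: "0 \<le> r" using L by (auto simp: M_def r_def)
      have clD: "closure D = {0..1}" unfolding D_def by (rule closure_dyadic_levels)
      have fA: "f ` D \<subseteq> A"
      proof -
        have "f (real j / 2 ^ i) \<in> A" if "j \<le> 2 ^ i" for i j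
        \<comment> \<open>Nodes are read off as right endpoints of intervals, which leaves out
          \<open>0\<close>.\<close>
        proof (cases "j = 0")
          case True
          then show ?thesis using f01 x by simp
        next
          case False
          then show ?thesis using curve_construction_nodes[OF f[rule_format] x order_refl, of j i] that
            by simp
        qed
        then show ?thesis unfolding D_def by (auto elim: dyadic_levelE)
      qed
      have defect: "norm (f t - ((1 - t) *\<^sub>R x0 + t *\<^sub>R x1)) \<le> 2 * r * min t (1 - t)" if tD: "t \<in> D" for t
      proof -
        obtain i j where t: "t = real j / 2 ^ i" and j: "j \<le> 2 ^ i"
          using tD unfolding D_def by (blast elim: dyadic_levelE)
        interpret ref: dyadic_refinement f K R "s - 1" i by (rule refinement) (use f in blast)
        show ?thesis
          using ref.norm_defect_le'[OF order_refl j]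
          unfolding ref.defect_def ref.B_def ref.q_def ref.\<theta>_def f01 t r_def L_def q_def by simp
      qed
      have Lip: "norm (f t - f t') \<le> M * \<bar>t - t'\<bar>" if tD: "t \<in> D" "t' \<in> D" for t t'
      proof -
        obtain i i' where "t \<in> dyadic_level i" "t' \<in> dyadic_level i'" using tD by (auto simp: D_def)
        \<comment> \<open>On a common level the Lipschitz bound applies, with a constant independent
          of the level.\<close>
        then have "t \<in> dyadic_level (max i i')" "t' \<in> dyadic_level (max i i')"
          using dyadic_level_mono[of i "max i i'"] dyadic_level_mono[of i' "max i i'"] by auto
        then obtain k j j' where t: "t = real j / 2 ^ k" "t' = real j' / 2 ^ k"
          and j: "j \<le> 2 ^ k" "j' \<le> 2 ^ k" by (meson dyadic_levelE)
        interpret ref: dyadic_refinement f K R "s - 1" k by (rule refinement) (use f in blast)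
        have le: "norm (f (real b / 2 ^ k) - f (real a / 2 ^ k)) \<le> M * \<bar>real b / 2 ^ k - real a / 2 ^ k\<bar>"
          if "a \<le> b" "b \<le> 2 ^ k" for a b
        proof -
          have "real a / 2 ^ k \<le> real b / 2 ^ k" using that by (intro divide_right_mono) auto
          then show ?thesis
            using ref.dyadic_Lipschitz[OF order_refl that]
            by (simp add: ref.B_def ref.q_def f01 M_def q_def)
        qed
        show ?thesis
        proof (cases "j' \<le> j")
          case True
          then show ?thesis using le[of j' j] j by (simp add: t)
        next
          case False
          then show ?thesis using le[of j j'] j by (simp add: t norm_minus_commute abs_minus_commute)
        qed
      qed
      \<comment> \<open>A Lipschitz map into a complete space extends continuously to the closure,
        here all of the unit interval.\<close>
      have "M-lipschitz_on D f"
        using Lip M by (auto simp: lipschitz_on_def dist_norm)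
      then obtain g where g: "uniformly_continuous_on (closure D) g" "\<And>t. t \<in> D \<Longrightarrow> f t = g t"
        using uniformly_continuous_on_extension_on_closure[OF lipschitz_on_uniformly_continuous] by metis
      have cg: "continuous_on (closure D) g" using g(1) by (rule uniformly_continuous_imp_continuous)
      have "0 \<in> dyadic_level 0" "1 \<in> dyadic_level 0" by (auto simp: dyadic_level_def)
      then have D01: "0 \<in> D" "1 \<in> D" by (auto simp: D_def)
      have gA: "g ` {0..1} \<subseteq> A"
        unfolding clD[symmetric] by (rule image_closure_subset[OF cg closed]) (use fA g(2) in auto)
      \<comment> \<open>The defect bound is a closed condition and so passes from the dyadic
        parameters to their closure.\<close>
      define \<phi> where "\<phi> t = 2 * r * min t (1 - t) - norm (g t - ((1 - t) *\<^sub>R x0 + t *\<^sub>R x1))" for t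
      have "\<phi> ` closure D \<subseteq> {0..}"
      proof (rule image_closure_subset)
        show "continuous_on (closure D) \<phi>" unfolding \<phi>_def by (intro continuous_intros cg)
        show "\<phi> ` D \<subseteq> {0..}" using defect g(2) by (auto simp: \<phi>_def)
      qed simp
      then have \<phi>: "0 \<le> \<phi> t" if "t \<in> {0..1}" for t using that unfolding clD by blast
      have hull: "g t \<in> convex hull ({x0} \<union> cball (midpoint x0 x1) r \<union> {x1})" if "t \<in> {0..1}" for t
      proof (rule in_hull_of_tapered_tube[OF that r])
        show "norm (g t - ((1 - t) *\<^sub>R x0 + t *\<^sub>R x1)) \<le> 2 * r * min t (1 - t)"
          using \<phi>[OF that] by (simp add: \<phi>_def)
      qed
      show "\<exists>g :: real \<Rightarrow> 'a.
          continuous_on {0..1} g \<and>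
          g ` {0..1} \<subseteq> A \<and>
          (\<forall>i. \<forall>t\<in>dyadic_level i. g t = f t) \<and>
          g 0 = x0 \<and> g 1 = x1 \<and>
          g ` {0..1} \<subseteq> convex hull
            ({x0} \<union>
             cball (midpoint x0 x1) (L * norm (x0 - x1) * (norm (x0 - x1) / R) powr (s - 1)) \<union>
             {x1})"
      proof (intro exI[of _ g] conjI allI ballI)
        show "g t = f t" if "t \<in> dyadic_level i" for i t
        proof (rule g(2)[symmetric])
          show "t \<in> D" using that unfolding D_def by blast
        qed
      qed (use cg gA g(2)[OF D01(1)] g(2)[OF D01(2)] f01 hull in \<open>auto simp: clD r_def\<close>)
    qed
  qed
  show ?thesis
    by (rule exI[of _ \<beta>], rule conjI[OF \<beta>], rule exI[of _ L], rule conjI[OF L],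
        intro allI ballI impI, rule main)
qed

end
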